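(* Let $N\ge1$. Assume $f\in C^0([0,\infty))\cap C^2((0,\infty))$ is nondecreasing and convex, $f>0$ in $(0,\infty)$, and the limit $q_0=\lim_{u\to0^+}q(u)$ exists in $\overline{\mathbb{R}}$; let $p_0$ be the conjugate exponent of $q_0$. Assume $u\in C^2(\mathbb{R}^N)$ is a bounded, nonnegative solution of $-\Delta u=f(u)$ in $\mathbb{R}^N$ which is stable outside a compact set. Assume that $p_0$ is subcritical, i.e. $$p_0<\infty\ \text{ if } N\le2,\qquad p_0<\frac{N+2}{N-2}\ \text{ if } N\ge3,$$ and that $$(p_0+1)F(s)\ge s f(s)\qquad\text{for all } s\ge0,$$ where $F(s)=\int_0^sf(t)\,dt$. Then $u=0$.
   Context: For $u>0$, $q(u)=\dfrac{f'(u)^2}{f(u)f''(u)}$ if $f(u)f''(u)\ne0$, and $q(u)=+\infty$ otherwise. The conjugate exponent $p_0\in\overline{\mathbb{R}}$ of $q_0$ is defined by $1/p_0+1/q_0=1$, i.e. $p_0=q_0/(q_0-1)$ if $q_0\notin\{1,+\infty\}$, $p_0=+\infty$ if $q_0=1$, $p_0=1$ if $q_0=+\infty$. A solution $u$ of $-\Delta u=f(u)$ in $\mathbb{R}^N$ is stable outside a compact set if there is a compact set $K\subset\mathbb{R}^N$ such that $\int_{\mathbb{R}^N} f'(u)\varphi^2\,dx\le\int_{\mathbb{R}^N}|\nabla\varphi|^2\,dx$ for all $\varphi\in C^1_c(\mathbb{R}^N\setminus K)$; here $f'(0)$ denotes the right derivative of $f$ at $0$ (which exists and is finite by convexity and monotonicity).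 *)

theory Defs
  imports "HOL-Analysis.Analysis"
begin

definition C2_real_on :: "real set \<Rightarrow> (real \<Rightarrow> real) \<Rightarrow> bool" where
  "C2_real_on S f \<longleftrightarrow>
     (\<forall>x\<in>S. f differentiable (at x) \<and> deriv f differentiable (at x)) \<and>
     continuous_on S (deriv (deriv f))"

definition partial_deriv :: "'a::euclidean_space \<Rightarrow> ('a \<Rightarrow> real) \<Rightarrow> 'a \<Rightarrow> real" where
  "partial_deriv b g x = frechet_derivative g (at x) b"

definition C1_fun :: "('a::euclidean_space \<Rightarrow> real) \<Rightarrow> bool" where
  "C1_fun g \<longleftrightarrow>
     (\<forall>x. g differentiable (at x)) \<and> (\<forall>b\<in>Basis. continuous_on UNIV (partial_deriv b g))"

definition C2_fun :: "('a::euclidean_space \<Rightarrow> real) \<Rightarrow> bool" where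
  "C2_fun g \<longleftrightarrow> C1_fun g \<and> (\<forall>b\<in>Basis. C1_fun (partial_deriv b g))"

definition gradient :: "('a::euclidean_space \<Rightarrow> real) \<Rightarrow> 'a \<Rightarrow> 'a" where
  "gradient g x = (\<Sum>b\<in>Basis. partial_deriv b g x *\<^sub>R b)"

definition laplacian :: "('a::euclidean_space \<Rightarrow> real) \<Rightarrow> 'a \<Rightarrow> real" where
  "laplacian g x = (\<Sum>b\<in>Basis. partial_deriv b (partial_deriv b g) x)"

definition q_fun :: "(real \<Rightarrow> real) \<Rightarrow> real \<Rightarrow> ereal" where
  "q_fun f u = (if f u * deriv (deriv f) u \<noteq> 0
     then ereal ((deriv f u)\<^sup>2 / (f u * deriv (deriv f) u)) else \<infinity>)"

text \<open>The value at minus infinity is the one forced by 1/p + 1/q = 1; it is never relevant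
  for convex positive f, since then \<open>q_fun f\<close> is nonnegative on the positive half-line.\<close>

definition conj_exponent :: "ereal \<Rightarrow> ereal" where
  "conj_exponent q = (if q = 1 then \<infinity> else if \<bar>q\<bar> = \<infinity> then 1 else q / (q - 1))"

text \<open>The derivative of a function on the closed half-line: at 0 it is the right derivative.\<close>

definition deriv_half_line :: "(real \<Rightarrow> real) \<Rightarrow> real \<Rightarrow> real" where
  "deriv_half_line f s = (if s = 0 then vector_derivative f (at_right 0) else deriv f s)"

text \<open>A function in C1 with compact support in the complement of K is represented by its
  extension by zero to the whole space.\<close>

definition stable_outside_compact ::
  "(real \<Rightarrow> real) \<Rightarrow> ('a::euclidean_space \<Rightarrow> real) \<Rightarrow> bool" where
  "stable_outside_compact f u \<longleftrightarrow>
     (\<exists>K. compact K \<and>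
        (\<forall>\<phi>. C1_fun \<phi> \<and> compact (closure (support_on UNIV \<phi>)) \<and>
               closure (support_on UNIV \<phi>) \<subseteq> - K \<longrightarrow>
             (LINT x|lborel. deriv_half_line f (u x) * (\<phi> x)\<^sup>2)
               \<le> (LINT x|lborel. (norm (gradient \<phi> x))\<^sup>2)))"

end

theory Submission
  imports Defs
begin

text \<open>
  Near 0 the derivative of f / f' is 1 - 1 / q, so s f' (s) / f (s) tends to p0; hence f (s)
  dominates a multiple of s to the power P on the range of u for every P > p0. If N is at most 2, or
  p0 = 1, or f (0) > 0, this makes u a supersolution in Serrin's range, and testing the equation with
  a power of max 0 (1 - |x|^2 / R^2) already forces f (u) = 0.

  Otherwise p0 > 1 and convexity upgrades the limit to (1 + d) f (s) <= s f' (s) on the range of u.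
  Testing stability with u psi gives d times the integral of u f (u) psi^2 at most that of
  u^2 |grad psi|^2, and a pointwise Young inequality absorbs the right-hand side into the left,
  because P is subcritical. So u f (u) and |grad u|^2 are integrable, the latter with the smaller
  integral. The Pohozaev identity on the whole space and the hypothesis on F then contradict
  subcriticality unless the integral of F (u) vanishes.
\<close>

section \<open>Hessians and the divergence theorem\<close>

text \<open>Both thresholds come from one scaling count. A cutoff at scale R costs a factor R^-2,
  and absorbing R^-2 u^k into u^(k + q) leaves an error of order R^(N - 2 - 2k/q) over the ball of
  radius R. For k = 1 (the equation tested with a cutoff) it vanishes for N \<ge> 3 when q + 1 <
  N/(N - 2); for k = 2 (energy estimates) when q + 1 < (N + 2)/(N - 2), which is the full
  subcritical range. The k = 2 estimate starts from stability minus the equation, which leaves (s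
  f'(s) - f(s)) s at s = u. This controls u f(u) only if s f'(s)/f(s) stays away from 1. Hence p0 =
  1 has to go to the k = 1 estimate, where an exponent slightly above 1 is always admissible. Two
  obstacles shape the details. The limit p0 speaks only about small s, so monotonicity and convexity
  of f must carry its consequences over the bounded range of u. And f is C2 only on the open
  half-line while u may vanish, so f'(u) is handled through the product f'(u) u^2, and F is
  differentiated within the range of u only.\<close>

definition has_hessian ::
  "('a::euclidean_space \<Rightarrow> real) \<Rightarrow> ('a \<Rightarrow> 'a) \<Rightarrow> ('a \<Rightarrow> 'a \<Rightarrow> 'a) \<Rightarrow> bool" where
  "has_hessian u G H \<longleftrightarrow>
     (\<forall>x. (u has_derivative (\<lambda>h. G x \<bullet> h)) (at x)) \<and>
     (\<forall>x. (G has_derivative H x) (at x)) \<and>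
     (\<forall>h. continuous_on UNIV (\<lambda>x. H x h))"

lemma has_hessianD:
  assumes "has_hessian u G H"
  shows "(u has_derivative (\<lambda>h. G x \<bullet> h)) (at x)" "(G has_derivative H x) (at x)"
    "continuous_on UNIV (\<lambda>x. H x h)" "continuous_on UNIV u" "continuous_on UNIV G"
proof -
  show u: "(u has_derivative (\<lambda>h. G x \<bullet> h)) (at x)" and G: "(G has_derivative H x) (at x)"
    and "continuous_on UNIV (\<lambda>x. H x h)" for x
    using assms unfolding has_hessian_def by blast+
  show "continuous_on UNIV u" "continuous_on UNIV G"
    by (rule has_derivative_continuous_on, rule has_derivative_at_withinI, rule u G)+
qed

section \<open>From partial derivatives in coordinates to gradient fields\<close>

lemma partial_deriv_eqI:
  assumes "(g has_derivative g') (at x)"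
  shows "partial_deriv b g x = g' b"
  unfolding partial_deriv_def using frechet_derivative_at[OF assms] by metis

lemma gradient_eqI:
  assumes "(g has_derivative (\<lambda>h. v \<bullet> h)) (at x)"
  shows "gradient g x = v"
  unfolding gradient_def partial_deriv_eqI[OF assms] by (rule euclidean_representation)

lemma has_derivative_gradient:
  assumes "g differentiable (at x)"
  shows "(g has_derivative (\<lambda>h. gradient g x \<bullet> h)) (at x)"
proof -
  have d: "(g has_derivative frechet_derivative g (at x)) (at x)"
    using assms frechet_derivative_works by blast
  then interpret linear "frechet_derivative g (at x)"
    by (rule has_derivative_linear)
  have "gradient g x \<bullet> h = frechet_derivative g (at x) h" for h
  proof -
    have "frechet_derivative g (at x) h = frechet_derivative g (at x) (\<Sum>b\<in>Basis. (h \<bullet> b) *\<^sub>R b)"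
      by (simp add: euclidean_representation)
    also have "\<dots> = (\<Sum>b\<in>Basis. (h \<bullet> b) * frechet_derivative g (at x) b)"
      by (simp add: sum scale)
    also have "\<dots> = gradient g x \<bullet> h"
      by (simp add: gradient_def partial_deriv_def inner_sum_left inner_commute[of h] mult.commute)
    finally show ?thesis by simp
  qed
  then show ?thesis using d by simp
qed

lemma C1_funI:
  assumes "\<And>x. (g has_derivative (\<lambda>h. G x \<bullet> h)) (at x)" "continuous_on UNIV G"
  shows "C1_fun g"
  unfolding C1_fun_def
proof (intro conjI allI ballI)
  show "g differentiable (at x)" for x
    using assms(1) differentiable_def by blast
  fix b :: 'a assume "b \<in> Basis"
  have "partial_deriv b g = (\<lambda>x. G x \<bullet> b)"
    using partial_deriv_eqI[OF assms(1)] by auto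
  then show "continuous_on UNIV (partial_deriv b g)"
    using assms(2) by (auto intro!: continuous_intros)
qed

text \<open>\<open>C1_fun\<close> already contains total differentiability of each partial
  derivative, so the gradient field is differentiable component by component. From here on all
  calculus is free of coordinates; only traces sum over \<open>Basis\<close>.\<close>

lemma C2_fun_has_hessian:
  assumes "C2_fun u"
  obtains H where "has_hessian u (gradient u) H"
    "\<And>x. laplacian u x = (\<Sum>b\<in>Basis. H x b \<bullet> b)"
proof
  define H where "H x h = (\<Sum>b\<in>Basis. (gradient (partial_deriv b u) x \<bullet> h) *\<^sub>R b)" for x h
  have C1: "C1_fun u" "\<And>b. b \<in> Basis \<Longrightarrow> C1_fun (partial_deriv b u)"
    using assms by (auto simp: C2_fun_def)
  have "(gradient u has_derivative H x) (at x)" for x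
    unfolding gradient_def[abs_def] H_def[abs_def]
    using C1(2) by (auto intro!: derivative_eq_intros has_derivative_gradient simp: C1_fun_def gradient_def)
  moreover have "continuous_on UNIV (\<lambda>x. H x h)" for h
    unfolding H_def gradient_def using C1(2) 
    by (auto intro!: continuous_intros simp: C1_fun_def)
  ultimately show "has_hessian u (gradient u) H"
    using C1(1) by (auto simp: has_hessian_def C1_fun_def intro: has_derivative_gradient)
  show "laplacian u x = (\<Sum>b\<in>Basis. H x b \<bullet> b)" for x
    unfolding laplacian_def H_def
    by (intro sum.cong refl) (simp add: inner_sum_left inner_Basis if_distrib gradient_def cong: if_cong)
qed

section \<open>Symmetry of second derivatives\<close>

lemma hessian_second_difference:
  assumes u: "has_hessian u G H" and s: "0 < s"
  obtains t1 t2 where "t1 \<in> {0<..<s}" "t2 \<in> {0<..<s}"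
    "u (x + s *\<^sub>R h + s *\<^sub>R k) - u (x + s *\<^sub>R h) - u (x + s *\<^sub>R k) + u x
       = s\<^sup>2 * (H (x + t1 *\<^sub>R h + t2 *\<^sub>R k) k \<bullet> h)"
proof -
  have lin: "linear (H x)" for x
    using has_hessianD(2)[OF u] by (rule has_derivative_linear)
  have line: "((\<lambda>t. y + t *\<^sub>R v) has_derivative (\<lambda>e. e *\<^sub>R v)) (at t within S)" for y v :: 'a and t S
    by (auto intro!: derivative_eq_intros)
  have du: "((\<lambda>t. u (y + t *\<^sub>R v)) has_derivative (\<lambda>e. e * (G (y + t *\<^sub>R v) \<bullet> v))) (at t within S)" for y v t S
    using has_derivative_compose[OF line has_hessianD(1)[OF u]] by simp
  have dG: "((\<lambda>t. G (y + t *\<^sub>R v)) has_derivative (\<lambda>e. e *\<^sub>R H (y + t *\<^sub>R v) v)) (at t within S)" for y v t S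
    using has_derivative_compose[OF line has_hessianD(2)[OF u]] by (simp add: linear_cmul[OF lin])
  \<comment> \<open>The increment over \<open>s *\<^sub>R k\<close>, viewed as a function of the
    position along \<open>h\<close>. One mean value theorem acts along \<open>h\<close> on this
    increment, a second one along \<open>k\<close> on the resulting difference of gradients.\<close>
  define p where "p t = u ((x + s *\<^sub>R k) + t *\<^sub>R h) - u (x + t *\<^sub>R h)" for t
  have "\<exists>t\<in>{0<..<s}. p s - p 0 = (s - 0) * (G ((x + s *\<^sub>R k) + t *\<^sub>R h) \<bullet> h - G (x + t *\<^sub>R h) \<bullet> h)"
    by (rule mvt_simple[of 0 s p "\<lambda>t d. d * (G ((x + s *\<^sub>R k) + t *\<^sub>R h) \<bullet> h - G (x + t *\<^sub>R h) \<bullet> h)"])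
       (use s in \<open>auto intro!: has_derivative_eq_rhs[OF has_derivative_diff[OF du du]] simp: p_def[abs_def] right_diff_distrib\<close>)
  then obtain t1 where t1: "t1 \<in> {0<..<s}"
    "p s - p 0 = s * (G (x + t1 *\<^sub>R h + s *\<^sub>R k) \<bullet> h - G (x + t1 *\<^sub>R h) \<bullet> h)"
    by (auto simp: algebra_simps)
  define r where "r t = G (x + t1 *\<^sub>R h + t *\<^sub>R k) \<bullet> h" for t
  have "\<exists>t\<in>{0<..<s}. r s - r 0 = (s - 0) * (H (x + t1 *\<^sub>R h + t *\<^sub>R k) k \<bullet> h)"
    by (rule mvt_simple[of 0 s r "\<lambda>t d. d * (H (x + t1 *\<^sub>R h + t *\<^sub>R k) k \<bullet> h)"])
       (use s in \<open>auto intro!: has_derivative_eq_rhs[OF has_derivative_inner_left[OF dG]] simp: r_def[abs_def]\<close>)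
  then obtain t2 where t2: "t2 \<in> {0<..<s}" "r s - r 0 = s * (H (x + t1 *\<^sub>R h + t2 *\<^sub>R k) k \<bullet> h)" by auto
  have "u (x + s *\<^sub>R h + s *\<^sub>R k) - u (x + s *\<^sub>R h) - u (x + s *\<^sub>R k) + u x = p s - p 0"
    by (simp add: p_def algebra_simps)
  also have "\<dots> = s * (r s - r 0)"
    unfolding t1(2) r_def by simp
  also have "\<dots> = s\<^sup>2 * (H (x + t1 *\<^sub>R h + t2 *\<^sub>R k) k \<bullet> h)"
    unfolding t2(2) power2_eq_square by (simp only: mult.assoc)
  finally show ?thesis
    by (rule that[OF t1(1) t2(1)])
qed

text \<open>The second difference does not change when \<open>h\<close> and \<open>k\<close> are
  swapped, but its two mean value representations evaluate the two sides of the claim, at points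
  that tend to \<open>x\<close> with \<open>s\<close>. The Pohozaev identity needs this to cancel
  its second-order terms.\<close>

lemma hessian_symmetric:
  assumes u: "has_hessian u G H"
  shows "H x k \<bullet> h = H x h \<bullet> k"
proof (rule ccontr)
  assume ne: "H x k \<bullet> h \<noteq> H x h \<bullet> k"
  define a c' d where "a = H x k \<bullet> h" and "c' = H x h \<bullet> k" and "d = \<bar>a - c'\<bar> / 2"
  have d: "d > 0" using ne by (simp add: d_def a_def c'_def)
  have c: "isCont (\<lambda>y. H y k \<bullet> h) x" for h k
    using has_hessianD(3)[OF u, of k] by (auto intro!: continuous_intros simp: continuous_on_eq_continuous_at)
  obtain e1 where e1: "e1 > 0" "\<And>y. dist y x < e1 \<Longrightarrow> dist (H y k \<bullet> h) (H x k \<bullet> h) < d"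
    using c[of k h] d unfolding continuous_at_eps_delta by meson
  obtain e2 where e2: "e2 > 0" "\<And>y. dist y x < e2 \<Longrightarrow> dist (H y h \<bullet> k) (H x h \<bullet> k) < d"
    using c[of h k] d unfolding continuous_at_eps_delta by meson
  define s where "s = min e1 e2 / (norm h + norm k + 1)"
  have np: "norm h + norm k + 1 > 0" by (simp add: add_nonneg_pos)
  have s: "s > 0" using e1 e2 np by (simp add: s_def)
  have close: "dist (x + t1 *\<^sub>R h + t2 *\<^sub>R k) x < min e1 e2" if "t1 \<in> {0<..<s}" "t2 \<in> {0<..<s}" for t1 t2
  proof -
    have "dist (x + t1 *\<^sub>R h + t2 *\<^sub>R k) x = norm (t1 *\<^sub>R h + t2 *\<^sub>R k)"
      by (simp add: dist_norm algebra_simps)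
    also have "\<dots> \<le> t1 * norm h + t2 * norm k"
      using that by (intro norm_triangle_le) auto
    also have "\<dots> \<le> s * norm h + s * norm k"
      using that by (intro add_mono mult_right_mono) auto
    also have "\<dots> < s * (norm h + norm k + 1)"
      using s by (simp add: algebra_simps)
    also have "\<dots> = min e1 e2" using np by (simp add: s_def)
    finally show ?thesis .
  qed
  obtain t1 t2 where t: "t1 \<in> {0<..<s}" "t2 \<in> {0<..<s}"
    "u (x + s *\<^sub>R h + s *\<^sub>R k) - u (x + s *\<^sub>R h) - u (x + s *\<^sub>R k) + u x
       = s\<^sup>2 * (H (x + t1 *\<^sub>R h + t2 *\<^sub>R k) k \<bullet> h)"
    using hessian_second_difference[OF u s, where h = h and k = k] .
  obtain r1 r2 where r: "r1 \<in> {0<..<s}" "r2 \<in> {0<..<s}"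
    "u (x + s *\<^sub>R k + s *\<^sub>R h) - u (x + s *\<^sub>R k) - u (x + s *\<^sub>R h) + u x
       = s\<^sup>2 * (H (x + r1 *\<^sub>R k + r2 *\<^sub>R h) h \<bullet> k)"
    using hessian_second_difference[OF u s, where h = k and k = h] .
  have "s\<^sup>2 * (H (x + t1 *\<^sub>R h + t2 *\<^sub>R k) k \<bullet> h) = s\<^sup>2 * (H (x + r1 *\<^sub>R k + r2 *\<^sub>R h) h \<bullet> k)"
    using t(3) r(3) by (simp add: algebra_simps)
  then have eq: "H (x + t1 *\<^sub>R h + t2 *\<^sub>R k) k \<bullet> h = H (x + r2 *\<^sub>R h + r1 *\<^sub>R k) h \<bullet> k"
    using s by (simp add: algebra_simps)
  define X where "X = H (x + t1 *\<^sub>R h + t2 *\<^sub>R k) k \<bullet> h"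
  have "dist X a < d"
    unfolding X_def a_def by (rule e1(2)) (use close[OF t(1,2)] in auto)
  moreover have "dist X c' < d"
    unfolding X_def eq c'_def by (rule e2(2)) (use close[OF r(2,1)] in auto)
  ultimately have "dist a c' < 2 * d"
    using dist_triangle2[of a c' X] by (simp add: dist_commute)
  moreover have "2 * d = dist a c'"
    by (simp add: d_def dist_real_def)
  ultimately show False by simp
qed

section \<open>Integrals of compactly supported fields\<close>

lemma integrable_compact_support:
  fixes g :: "'a::euclidean_space \<Rightarrow> real"
  assumes "continuous_on UNIV g" "\<And>x. norm x > R \<Longrightarrow> g x = 0"
  shows "integrable lborel g"
proof -
  have "integrable lborel (\<lambda>x. indicator (cball 0 R) x *\<^sub>R g x)"
    by (intro borel_integrable_compact) (auto intro: continuous_on_subset[OF assms(1)])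
  also have "(\<lambda>x. indicator (cball 0 R) x *\<^sub>R g x) = g"
    using assms(2) by (auto simp: indicator_def fun_eq_iff not_le)
  finally show ?thesis .
qed

lemma bounded_compact_support:
  fixes g :: "'a::euclidean_space \<Rightarrow> real"
  assumes "continuous_on UNIV g" "\<And>x. norm x > R \<Longrightarrow> g x = 0"
  obtains B where "B \<ge> 0" "\<And>x. \<bar>g x\<bar> \<le> B"
proof -
  have "bounded (g ` cball 0 R)"
    by (intro compact_imp_bounded compact_continuous_image) (auto intro: continuous_on_subset[OF assms(1)])
  then obtain B where B: "\<forall>y\<in>g ` cball 0 R. norm y \<le> B"
    unfolding bounded_iff by metis
  have "\<bar>g x\<bar> \<le> \<bar>B\<bar>" for x
    using bspec[OF B, of "g x"] assms(2)[of x] by (cases "norm x \<le> R") auto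
  then show ?thesis using that[of "\<bar>B\<bar>"] by auto
qed

text \<open>Translation invariance: the integral of h (x + t b) does not depend on t; differentiate at t = 0.\<close>

lemma integral_directional_derivative_eq_0:
  fixes h :: "'a::euclidean_space \<Rightarrow> real"
  assumes d: "\<And>x. (h has_derivative h' x) (at x)" and c: "continuous_on UNIV (\<lambda>x. h' x b)"
    and z: "\<And>x. norm x > R \<Longrightarrow> h x = 0"
  shows "integrable lborel (\<lambda>x. h' x b)" "(LINT x|lborel. h' x b) = 0"
proof -
  have lin: "linear (h' x)" for x
    using d by (rule has_derivative_linear)
  have z': "h' x b = 0" if "norm x > R" for x
  proof -
    have "((\<lambda>_. 0) has_derivative h' x) (at x)"
      by (rule has_derivative_transform_within_open[OF d, of "{x. norm x > R}"])
         (use that z in \<open>auto intro!: open_Collect_less continuous_intros\<close>)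
    then have "h' x = (\<lambda>_. 0)"
      using has_derivative_unique[OF _ has_derivative_const] by blast
    then show ?thesis by simp
  qed
  show int': "integrable lborel (\<lambda>x. h' x b)"
    by (rule integrable_compact_support[OF c z'])
  have ch: "continuous_on UNIV h"
    by (rule has_derivative_continuous_on[OF has_derivative_at_withinI[OF d]])
  have int: "integrable lborel h"
    by (rule integrable_compact_support[OF ch z])
  obtain B where B: "B \<ge> 0" "\<And>x. \<bar>h' x b\<bar> \<le> B"
    using bounded_compact_support[OF c z'] by blast
  define t where "t n = 1 / real (Suc n)" for n
  define s where "s n x = (h (x + t n *\<^sub>R b) - h x) / t n" for n x
  have t: "t n > 0" "t n \<le> 1" for n by (auto simp: t_def)
  have t0: "t \<longlonglongrightarrow> 0" unfolding t_def by (rule LIMSEQ_Suc[OF lim_1_over_n])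
  have dt: "((\<lambda>r. h (x + r *\<^sub>R b)) has_derivative (\<lambda>e. e * h' (x + r *\<^sub>R b) b)) (at r)" for x r
  proof -
    have "((\<lambda>r. h (x + r *\<^sub>R b)) has_derivative (\<lambda>e. h' (x + r *\<^sub>R b) (e *\<^sub>R b))) (at r)"
      by (rule has_derivative_compose[where g = h, OF _ d]) (auto intro!: derivative_eq_intros)
    then show ?thesis by (simp add: linear_cmul[OF lin])
  qed
  have lim: "(\<lambda>n. s n x) \<longlonglongrightarrow> h' x b" for x
  proof -
    have "((\<lambda>r. h (x + r *\<^sub>R b)) has_field_derivative h' x b) (at 0)"
      by (rule has_derivative_imp_has_field_derivative[OF dt[of x 0]]) simp
    then have "((\<lambda>e. (h (x + e *\<^sub>R b) - h x) / e) \<longlongrightarrow> h' x b) (at 0)"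
      unfolding DERIV_def by simp
    moreover have "filterlim t (at 0) sequentially"
      using t0 t(1) by (simp add: filterlim_at less_imp_neq[symmetric])
    ultimately show ?thesis unfolding s_def
      by (rule filterlim_compose)
  qed
  \<comment> \<open>Since \<open>t n \<le> 1\<close>, a translation moves the support by at most
    \<open>norm b\<close>, so all difference quotients live in one ball; the mean value theorem
    bounds them there. This is the dominating function.\<close>
  have bd: "\<bar>s n x\<bar> \<le> indicator (cball 0 (R + norm b)) x * B" for n x
  proof (cases "norm x \<le> R + norm b")
    case True
    have "\<exists>r\<in>{0<..<t n}. h (x + t n *\<^sub>R b) - h (x + 0 *\<^sub>R b) = (t n - 0) * h' (x + r *\<^sub>R b) b"
      by (rule mvt_simple[of 0 "t n" "\<lambda>r. h (x + r *\<^sub>R b)" "\<lambda>r e. e * h' (x + r *\<^sub>R b) b"])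
         (use t in \<open>auto intro: has_derivative_at_withinI dt\<close>)
    then obtain r where "h (x + t n *\<^sub>R b) - h x = t n * h' (x + r *\<^sub>R b) b" by auto
    then have "s n x = h' (x + r *\<^sub>R b) b" using t[of n] by (simp add: s_def)
    then show ?thesis using B(2) True by (simp add: indicator_def)
  next
    case False
    have "norm (t n *\<^sub>R b) \<le> norm b" using t[of n] by (simp add: mult_left_le_one_le)
    moreover have "norm x \<le> norm (x + t n *\<^sub>R b) + norm (t n *\<^sub>R b)"
      using norm_triangle_ineq4[of "x + t n *\<^sub>R b" "t n *\<^sub>R b"] by simp
    ultimately have "norm (x + t n *\<^sub>R b) > R" using False by linarith
    moreover have "norm x > R" using False norm_ge_zero[of b] by linarith
    ultimately show ?thesis using z False by (simp add: s_def indicator_def)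
  qed
  have shift: "integrable lborel (\<lambda>x. h (x + v)) \<and> (LINT x|lborel. h (x + v)) = (LINT x|lborel. h x)" for v
  proof -
    have m: "h \<in> borel_measurable borel" using int by (simp add: borel_measurable_integrable)
    have "integrable (distr lborel borel ((+) v)) h" using int by (simp add: lborel_distr_plus)
    then have "integrable lborel (\<lambda>x. h (v + x))" by (subst (asm) integrable_distr_eq) (use m in auto)
    moreover have "(LINT x|lborel. h (v + x)) = integral\<^sup>L (distr lborel borel ((+) v)) h"
      by (rule integral_distr[symmetric]) (use m in auto)
    ultimately show ?thesis by (simp add: lborel_distr_plus add.commute)
  qed
  have "(\<lambda>n. LINT x|lborel. s n x) \<longlonglongrightarrow> (LINT x|lborel. h' x b)"
  proof (rule integral_dominated_convergence[where w = "\<lambda>x. indicator (cball 0 (R + norm b)) x * B"])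
    show "(\<lambda>x. h' x b) \<in> borel_measurable lborel" using int' by simp
    show "s n \<in> borel_measurable lborel" for n
      unfolding s_def using shift int by (intro borel_measurable_divide borel_measurable_diff) (auto intro!: borel_measurable_integrable)
    show "integrable lborel (\<lambda>x. indicator (cball (0::'a) (R + norm b)) x * B)"
      using emeasure_lborel_cball_finite[of "0::'a" "R + norm b"]
      by (intro integrable_mult_left integrable_real_indicator) auto
  qed (use lim bd in auto)
  moreover have "(LINT x|lborel. s n x) = 0" for n
    unfolding s_def using shift int by simp
  ultimately show "(LINT x|lborel. h' x b) = 0"
    by (simp add: LIMSEQ_const_iff)
qed

lemma integral_divergence_eq_0:
  fixes V :: "'a::euclidean_space \<Rightarrow> 'a"
  assumes d: "\<And>x. (V has_derivative D x) (at x)"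
    and c: "\<And>b. b \<in> Basis \<Longrightarrow> continuous_on UNIV (\<lambda>x. D x b)"
    and z: "\<And>x. norm x > R \<Longrightarrow> V x = 0"
  shows "(LINT x|lborel. (\<Sum>b\<in>Basis. D x b \<bullet> b)) = 0"
proof -
  have *: "integrable lborel (\<lambda>x. D x b \<bullet> b) \<and> (LINT x|lborel. D x b \<bullet> b) = 0" if "b \<in> Basis" for b
  proof -
    have "((\<lambda>x. V x \<bullet> b) has_derivative (\<lambda>h. D x h \<bullet> b)) (at x)" for x
      by (rule has_derivative_inner_left[OF d])
    moreover have "continuous_on UNIV (\<lambda>x. D x b \<bullet> b)"
      by (intro continuous_intros c[OF that])
    moreover have "norm x > R \<Longrightarrow> V x \<bullet> b = 0" for x
      using z by simp
    ultimately show ?thesis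
      using integral_directional_derivative_eq_0[of "\<lambda>x. V x \<bullet> b" "\<lambda>x h. D x h \<bullet> b" b R] by blast
  qed
  then show ?thesis by (subst Bochner_Integration.integral_sum) auto
qed

section \<open>Truncated paraboloids as cutoffs\<close>

text \<open>Each derivative of a power costs one factor \<open>bump R x\<close> and one factor of
  order 1/R, because \<open>norm x\<close> is at most R on the support. Powers thus have explicit
  derivatives that are again controlled by lower powers, which is what absorption requires, and
  monotonicity in R gives monotone convergence.\<close>

definition bump :: "real \<Rightarrow> 'a::euclidean_space \<Rightarrow> real" where
  "bump R x = max 0 (1 - (x \<bullet> x) / R\<^sup>2)"

lemma bump_nonneg: "0 \<le> bump R x" and bump_le_1: "bump R x \<le> 1"
  by (auto simp: bump_def)

lemma bump_eq_0:
  assumes "R > 0" "norm x > R"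
  shows "bump R x = 0"
proof -
  have "R\<^sup>2 < x \<bullet> x"
    using assms by (simp add: power2_norm_eq_inner[symmetric] power_strict_mono)
  then show ?thesis using assms by (simp add: bump_def)
qed

lemma bump_nonzeroD:
  assumes "R > 0" "bump R x \<noteq> 0"
  shows "x \<bullet> x \<le> R\<^sup>2"
  using assms by (auto simp: bump_def max_def split: if_splits)

lemma bump_mono:
  assumes "0 < R" "R \<le> S"
  shows "bump R x \<le> bump S x"
proof -
  have "(x \<bullet> x) / S\<^sup>2 \<le> (x \<bullet> x) / R\<^sup>2"
    using assms by (intro divide_left_mono power_mono) auto
  then show ?thesis by (auto simp: bump_def)
qed

lemma bump_tendsto_1: "((\<lambda>R. bump R x) \<longlongrightarrow> 1) at_top"
proof -
  have "((\<lambda>R. max 0 (1 - (x \<bullet> x) / R\<^sup>2)) \<longlongrightarrow> max 0 (1 - 0)) at_top"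
    by (intro tendsto_max tendsto_diff tendsto_const tendsto_divide_0[OF tendsto_const]
        filterlim_at_top_imp_at_infinity filterlim_pow_at_top filterlim_ident) auto
  then show ?thesis by (simp add: bump_def)
qed

lemma continuous_on_bump [continuous_intros]: "continuous_on S (bump R)"
  unfolding bump_def[abs_def] divide_inverse by (intro continuous_intros)

lemma max_power_deriv:
  assumes "2 \<le> n"
  shows "((\<lambda>t::real. max 0 t ^ n) has_field_derivative real n * max 0 t ^ (n - 1)) (at t)"
proof -
  consider "t < 0" | "t = 0" | "t > 0" by linarith
  then show ?thesis
  proof cases
    case 1
    have "((\<lambda>_. 0) has_field_derivative real n * max 0 t ^ (n - 1)) (at t)"
      using 1 assms by (auto intro!: derivative_eq_intros)
    then show ?thesis
      by (rule has_field_derivative_transform_within_open[where S = "{..<0}"]) (use 1 assms in auto)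
  next
    case 3
    have "((\<lambda>t. t ^ n) has_field_derivative real n * max 0 t ^ (n - 1)) (at t)"
      using 3 by (auto intro!: derivative_eq_intros)
    then show ?thesis
      by (rule has_field_derivative_transform_within_open[where S = "{0<..}"]) (use 3 in auto)
  next
    case 2
    have "((\<lambda>h::real. max 0 h ^ n / h) \<longlongrightarrow> 0) (at 0)"
    proof (rule Lim_null_comparison)
      show "\<forall>\<^sub>F h in at 0. norm (max 0 h ^ n / h) \<le> max 0 (h::real) ^ (n - 1)"
      proof (rule always_eventually, rule allI)
        fix h :: real
        show "norm (max 0 h ^ n / h) \<le> max 0 h ^ (n - 1)"
          using assms by (cases "h > 0"; cases n) (auto simp: max_def)
      qed
      have "((\<lambda>h::real. max 0 h ^ (n - 1)) \<longlongrightarrow> max 0 0 ^ (n - 1)) (at 0)"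
        by (intro tendsto_intros)
      then show "((\<lambda>h::real. max 0 h ^ (n - 1)) \<longlongrightarrow> 0) (at 0)"
        using assms by (simp add: zero_power)
    qed
    then show ?thesis using assms 2 by (simp add: DERIV_def zero_power)
  qed
qed

lemma bump_power_derivative:
  assumes "2 \<le> n"
  shows "((\<lambda>x. bump R x ^ n) has_derivative (\<lambda>h. (- (2 * real n / R\<^sup>2) * bump R x ^ (n - 1)) *\<^sub>R x \<bullet> h)) (at x)"
proof -
  have i: "((\<lambda>x. 1 - (x \<bullet> x) / R\<^sup>2) has_derivative (\<lambda>h. - (2 / R\<^sup>2) * (x \<bullet> h))) (at x)"
    unfolding divide_inverse by (auto intro!: derivative_eq_intros simp: inner_commute algebra_simps)
  have "((\<lambda>x. max 0 (1 - (x \<bullet> x) / R\<^sup>2) ^ n) has_derivative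
      (\<lambda>h. real n * max 0 (1 - (x \<bullet> x) / R\<^sup>2) ^ (n - 1) * (- (2 / R\<^sup>2) * (x \<bullet> h)))) (at x)"
    using has_derivative_compose[OF i max_power_deriv[OF assms, unfolded has_field_derivative_def]] .
  then show ?thesis by (simp add: bump_def algebra_simps)
qed

text \<open>The exponent 3 leaves \<open>n - 1 \<ge> 2\<close> in the gradient, so the kink of the
  positive part is still smoothed out when differentiating a second time.\<close>

lemma bump_power_hessian:
  fixes n :: nat and R :: real
  assumes "3 \<le> n"
  defines "P \<equiv> \<lambda>x::'a::euclidean_space. (- (2 * real n / R\<^sup>2) * bump R x ^ (n - 1)) *\<^sub>R x"
  defines "Q \<equiv> \<lambda>(x::'a) h. (4 * real n * real (n - 1) / R ^ 4 * bump R x ^ (n - 2) * (x \<bullet> h)) *\<^sub>R x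
     - (2 * real n / R\<^sup>2 * bump R x ^ (n - 1)) *\<^sub>R h"
  shows "has_hessian (\<lambda>x. bump R x ^ n) P Q"
  unfolding has_hessian_def
proof (intro conjI allI)
  show "((\<lambda>x. bump R x ^ n) has_derivative (\<bullet>) (P x)) (at x)" for x
    unfolding P_def by (rule bump_power_derivative) (use assms in simp)
  show "continuous_on UNIV (\<lambda>x. Q x h)" for h
    unfolding Q_def by (intro continuous_intros)
  fix x :: 'a
  have "2 \<le> n - 1" "n - 1 - 1 = n - 2" using assms by auto
  then have b: "((\<lambda>x. bump R x ^ (n - 1)) has_derivative (\<lambda>h. (- (2 * real (n - 1) / R\<^sup>2) * bump R x ^ (n - 2)) * (x \<bullet> h))) (at x)"
    using bump_power_derivative[of "n - 1" R x] by simp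
  show "(P has_derivative Q x) (at x)"
    unfolding P_def Q_def
    by (rule has_derivative_eq_rhs[OF has_derivative_scaleR[OF has_derivative_mult_right[OF b] has_derivative_ident]])
       (simp add: fun_eq_iff algebra_simps power_numeral_reduce power2_eq_square)
qed

lemma trace_bump_power_hessian:
  fixes x :: "'a::euclidean_space"
  shows "(\<Sum>b\<in>Basis. ((c * (x \<bullet> b)) *\<^sub>R x - d *\<^sub>R b) \<bullet> b) = c * (x \<bullet> x) - d * DIM('a)"
proof -
  have "(\<Sum>b\<in>Basis. ((c * (x \<bullet> b)) *\<^sub>R x - d *\<^sub>R b) \<bullet> b) = (\<Sum>b\<in>Basis. c * ((x \<bullet> b) * (x \<bullet> b)) - d)"
    by (intro sum.cong refl) (simp add: inner_diff_left inner_Basis)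
  also have "\<dots> = c * (x \<bullet> x) - d * DIM('a)"
    by (simp add: sum_subtractf sum_distrib_left[symmetric] euclidean_inner[symmetric])
  finally show ?thesis .
qed

section \<open>Integration by parts against cutoffs\<close>

lemma integrable_bump:
  assumes "R > 0" "0 < n" "continuous_on UNIV g"
  shows "integrable lborel (\<lambda>x. bump R x ^ n * g x)"
  by (rule integrable_compact_support[where R = R])
     (use assms bump_eq_0[OF assms(1)] in \<open>auto intro!: continuous_intros simp: zero_power\<close>)

lemma continuous_on_trace:
  assumes "has_hessian v G H"
  shows "continuous_on UNIV (\<lambda>x. \<Sum>b\<in>Basis. H x b \<bullet> b)"
  by (intro continuous_intros has_hessianD(3)[OF assms])

text \<open>The field \<open>p x *\<^sub>R G x - v x *\<^sub>R P x\<close> has compact support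
  because of \<open>p\<close>, and the products of the two gradients cancel in its
  divergence.\<close>

lemma green:
  fixes v :: "'a::euclidean_space \<Rightarrow> real"
  assumes v: "has_hessian v G H" and p: "has_hessian p P Q"
    and z: "\<And>x. norm x > R \<Longrightarrow> p x = 0" "\<And>x. norm x > R \<Longrightarrow> P x = 0" "\<And>x h. norm x > R \<Longrightarrow> Q x h = 0"
  shows "(LINT x|lborel. p x * (\<Sum>b\<in>Basis. H x b \<bullet> b)) = (LINT x|lborel. v x * (\<Sum>b\<in>Basis. Q x b \<bullet> b))"
proof -
  define D where "D x h = (P x \<bullet> h) *\<^sub>R G x + p x *\<^sub>R H x h - ((G x \<bullet> h) *\<^sub>R P x + v x *\<^sub>R Q x h)" for x h
  note dv = has_hessianD[OF v] and dp = has_hessianD[OF p]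
  have "(LINT x|lborel. (\<Sum>b\<in>Basis. D x b \<bullet> b)) = 0"
  proof (rule integral_divergence_eq_0)
    show "((\<lambda>x. p x *\<^sub>R G x - v x *\<^sub>R P x) has_derivative D x) (at x)" for x
      unfolding D_def
      by (rule has_derivative_eq_rhs[OF has_derivative_diff[OF
            has_derivative_scaleR[OF dp(1) dv(2)] has_derivative_scaleR[OF dv(1) dp(2)]]])
         (simp add: fun_eq_iff)
    show "continuous_on UNIV (\<lambda>x. D x b)" for b
      unfolding D_def by (intro continuous_intros dv dp)
    show "norm x > R \<Longrightarrow> p x *\<^sub>R G x - v x *\<^sub>R P x = 0" for x
      using z by simp
  qed
  also have "(\<lambda>x. \<Sum>b\<in>Basis. D x b \<bullet> b)
     = (\<lambda>x. p x * (\<Sum>b\<in>Basis. H x b \<bullet> b) - v x * (\<Sum>b\<in>Basis. Q x b \<bullet> b))"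
    by (simp add: D_def inner_diff_left inner_add_left sum_subtractf sum.distrib sum_distrib_left mult.commute)
  also have "(LINT x|lborel. p x * (\<Sum>b\<in>Basis. H x b \<bullet> b) - v x * (\<Sum>b\<in>Basis. Q x b \<bullet> b))
    = (LINT x|lborel. p x * (\<Sum>b\<in>Basis. H x b \<bullet> b)) - (LINT x|lborel. v x * (\<Sum>b\<in>Basis. Q x b \<bullet> b))"
    by (intro Bochner_Integration.integral_diff integrable_compact_support[where R = R]
         continuous_intros continuous_on_trace[OF v] continuous_on_trace[OF p] dv dp)
       (auto simp: z)
  finally show ?thesis by simp
qed

text \<open>The Laplacian of \<open>bump R x ^ n\<close> is a difference of two nonnegative terms.
  Each estimate drops one of them, and the remaining one is of order 1/R^2, after using
  \<open>x \<bullet> x \<le> R\<^sup>2\<close> on the support in the second case. The first is used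
  with v = u, the second with v = u^2/2.\<close>

lemma integral_bump_laplacian:
  fixes v :: "'a::euclidean_space \<Rightarrow> real"
  assumes v: "has_hessian v G H" and nn: "\<And>x. v x \<ge> 0" and R: "R > 0" and n: "3 \<le> n"
  shows "- (LINT x|lborel. bump R x ^ n * (\<Sum>b\<in>Basis. H x b \<bullet> b))
      \<le> (LINT x|lborel. 2 * n * DIM('a) / R\<^sup>2 * bump R x ^ (n - 1) * v x)" (is ?A)
    and "(LINT x|lborel. bump R x ^ n * (\<Sum>b\<in>Basis. H x b \<bullet> b))
      \<le> (LINT x|lborel. 4 * real n * real (n - 1) / R\<^sup>2 * bump R x ^ (n - 2) * v x)" (is ?B)
proof -
  define T where "T x = 4 * real n * real (n - 1) / R ^ 4 * bump R x ^ (n - 2) * (x \<bullet> x)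
     - 2 * real n / R\<^sup>2 * bump R x ^ (n - 1) * DIM('a)" for x :: 'a
  have cv: "continuous_on UNIV v" by (rule has_hessianD[OF v])
  have z: "bump R x ^ k = 0" if "norm x > R" "k > 0" for x :: 'a and k
    using bump_eq_0[OF R that(1)] that(2) by simp
  have "(LINT x|lborel. bump R x ^ n * (\<Sum>b\<in>Basis. H x b \<bullet> b)) = (LINT x|lborel. v x * T x)"
    unfolding T_def trace_bump_power_hessian[symmetric]
    by (rule green[OF v bump_power_hessian[OF n, of R], of R]) (use n in \<open>simp_all add: z\<close>)
  moreover have c: "continuous_on UNIV T" unfolding T_def by (intro continuous_intros)
  have iT: "integrable lborel (\<lambda>x. v x * T x)"
    by (rule integrable_compact_support[where R = R])
       (use n R in \<open>auto intro!: continuous_intros cv c simp: z T_def\<close>)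
  have i: "integrable lborel (\<lambda>x. k / R\<^sup>2 * bump R x ^ l * v x)" if "l > 0" for k l
    by (rule integrable_compact_support[where R = R])
       (use that R in \<open>auto intro!: continuous_intros cv simp: z\<close>)
  have lo: "- T x \<le> 2 * n * DIM('a) / R\<^sup>2 * bump R x ^ (n - 1)" for x
    using bump_nonneg[of R x] R by (simp add: T_def algebra_simps zero_le_mult_iff zero_le_divide_iff)
  have hi: "T x \<le> 4 * real n * real (n - 1) / R\<^sup>2 * bump R x ^ (n - 2)" for x
  proof (cases "bump R x = 0")
    case True
    then show ?thesis using n by (simp add: T_def zero_power)
  next
    case False
    have "4 * real n * real (n - 1) / R ^ 4 * bump R x ^ (n - 2) * (x \<bullet> x)
      \<le> 4 * real n * real (n - 1) / R ^ 4 * bump R x ^ (n - 2) * R\<^sup>2"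
      using bump_nonzeroD[OF R False] bump_nonneg[of R x] by (intro mult_left_mono) auto
    also have "\<dots> = 4 * real n * real (n - 1) / R\<^sup>2 * bump R x ^ (n - 2)"
      using R by (simp add: field_simps power_numeral_reduce power2_eq_square)
    finally have "4 * real n * real (n - 1) / R ^ 4 * bump R x ^ (n - 2) * (x \<bullet> x) 
       \<le> 4 * real n * real (n - 1) / R\<^sup>2 * bump R x ^ (n - 2)" .
    moreover have "0 \<le> 2 * real n / R\<^sup>2 * bump R x ^ (n - 1) * DIM('a)"
      using bump_nonneg[of R x] by simp
    ultimately show ?thesis unfolding T_def by simp
  qed
  moreover have "(LINT x|lborel. v x * T x) \<le> (LINT x|lborel. 4 * real n * real (n - 1) / R\<^sup>2 * bump R x ^ (n - 2) * v x)"
  proof (intro integral_mono i iT)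
    show "v x * T x \<le> 4 * real n * real (n - 1) / R\<^sup>2 * bump R x ^ (n - 2) * v x" for x
      using mult_right_mono[OF hi[of x] nn[of x]] by (simp add: mult.commute)
  qed (use n in auto)
  moreover have "(LINT x|lborel. - (v x * T x)) \<le> (LINT x|lborel. 2 * n * DIM('a) / R\<^sup>2 * bump R x ^ (n - 1) * v x)"
  proof (intro integral_mono i)
    show "- (v x * T x) \<le> 2 * n * DIM('a) / R\<^sup>2 * bump R x ^ (n - 1) * v x" for x
      using mult_right_mono[OF lo[of x] nn[of x]] by (simp add: mult.commute)
  qed (use iT n in auto)
  ultimately show ?A ?B by simp_all
qed

text \<open>The truncated integrals increase with R, so a bound for large R holds for every R on the
  sequence 1, 2, ...; monotone convergence then yields integrability and the bound together.\<close>

lemma bump_integral_criterion: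
  fixes h :: "'a::euclidean_space \<Rightarrow> real"
  assumes c: "continuous_on UNIV h" and nn: "\<And>x. h x \<ge> 0" and n: "0 < n"
    and ev: "\<forall>\<^sub>F R in at_top. (LINT x|lborel. bump R x ^ n * h x) \<le> C"
  shows "integrable lborel h" "(LINT x|lborel. h x) \<le> C"
proof -
  define s where "s i x = bump (real (Suc i)) x ^ n * h x" for i x
  define I where "I i = (LINT x|lborel. s i x)" for i
  have int: "integrable lborel (s i)" for i
    unfolding s_def[abs_def] by (rule integrable_bump[OF _ n c]) simp
  have mono: "mono (\<lambda>i. s i x)" for x
    unfolding s_def mono_def by (auto intro!: mult_right_mono power_mono bump_mono bump_nonneg nn)
  have "mono I"
    unfolding I_def mono_def using mono by (auto intro!: integral_mono int simp: mono_def)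
  have f: "filterlim (\<lambda>i. real (Suc i)) at_top sequentially"
    by (rule filterlim_compose[OF filterlim_real_sequentially filterlim_Suc])
  have evI: "\<forall>\<^sub>F i in sequentially. I i \<le> C"
    using ev f unfolding I_def s_def filterlim_iff by blast
  have bd: "I i \<le> C" for i
  proof -
    obtain j where "j \<ge> i" "I j \<le> C"
      using evI unfolding eventually_sequentially by (metis max.cobounded1 max.cobounded2)
    then show ?thesis using \<open>mono I\<close> unfolding mono_def by (meson order_trans)
  qed
  obtain L where L: "I \<longlonglongrightarrow> L"
    by (rule incseq_convergent[of I C]) (use \<open>mono I\<close> bd in auto)
  have lim: "(\<lambda>i. s i x) \<longlonglongrightarrow> h x" for x
  proof -
    have "(\<lambda>i. bump (real (Suc i)) x ^ n * h x) \<longlonglongrightarrow> 1 ^ n * h x"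
      by (intro tendsto_mult_right tendsto_power filterlim_compose[OF bump_tendsto_1 f])
    then show ?thesis by (simp add: s_def)
  qed
  have m: "h \<in> borel_measurable lborel"
    using c by (simp add: borel_measurable_continuous_onI)
  have "s i x \<ge> 0" for i x
    unfolding s_def using nn bump_nonneg by (intro mult_nonneg_nonneg zero_le_power)
  note * = integral_monotone_convergence_nonneg[where f = s and u = h and x = L, OF int]
  show "integrable lborel h"
    by (rule *) (use mono lim L m \<open>\<And>i x. s i x \<ge> 0\<close> in \<open>auto simp: I_def[abs_def]\<close>)
  have "integral\<^sup>L lborel h = L"
    by (rule *) (use mono lim L m \<open>\<And>i x. s i x \<ge> 0\<close> in \<open>auto simp: I_def[abs_def]\<close>)
  then show "(LINT x|lborel. h x) \<le> C"
    using LIMSEQ_le_const2[OF L] bd by auto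
qed

lemma continuous_nonneg_integral_0:
  fixes h :: "'a::euclidean_space \<Rightarrow> real"
  assumes c: "continuous_on UNIV h" and nn: "\<And>x. h x \<ge> 0" and i: "integrable lborel h"
    and le: "(LINT x|lborel. h x) \<le> 0"
  shows "h x = 0"
proof (rule ccontr)
  assume "h x \<noteq> 0"
  then have p: "h x > 0" using nn[of x] by simp
  have "isCont h x" using c by (simp add: continuous_on_eq_continuous_at)
  then obtain d where d: "d > 0" "\<And>y. dist y x < d \<Longrightarrow> dist (h y) (h x) < h x / 2"
    using p unfolding continuous_at_eps_delta by (metis half_gt_zero)
  define e where "e = d / 2"
  have e: "e > 0" using d by (simp add: e_def)
  have "(LINT y|lborel. h x / 2 * indicator (cball x e) y) \<le> (LINT y|lborel. h y)"
  proof (rule integral_mono)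
    show "integrable lborel (\<lambda>y. h x / 2 * indicator (cball x e) y)"
      using emeasure_lborel_cball_finite[of x e]
      by (intro integrable_mult_right integrable_real_indicator) auto
    show "h x / 2 * indicator (cball x e) y \<le> h y" for y
    proof (cases "y \<in> cball x e")
      case True
      then have "dist (h y) (h x) < h x / 2"
        using d by (intro d(2)) (auto simp: e_def dist_commute)
      then have "h x / 2 \<le> h y" unfolding dist_real_def by linarith
      then show ?thesis using True by simp
    qed (use nn in simp)
  qed (rule i)
  moreover have "(LINT y|lborel. h x / 2 * indicator (cball x e) y) = h x / 2 * measure lborel (cball x e)"
    by simp
  moreover have "h x / 2 * measure lborel (cball x e) > 0"
    using p content_cball_pos[OF e] by simp
  ultimately show False using le by linarith
qed

text \<open>A case distinction replaces Young's inequality. If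
  \<open>A \<le> e * w ^ l * u powr q\<close>, the first term on the right dominates by itself.
  Otherwise u is bounded in terms of w, and the condition on \<open>n\<close> says that
  \<open>w ^ n\<close> compensates for the negative power of w in that bound.\<close>

lemma young_absorb:
  fixes w u q A e :: real and k l n :: nat
  assumes "A > 0" "e > 0" "q > 0" "0 \<le> w" "w \<le> 1" "u \<ge> 0" "k > 0" "l > 0" "real l * k / q \<le> n"
  shows "A * w ^ n * u ^ k \<le> e * w ^ (n + l) * (u ^ k * u powr q) + A * (A / e) powr (k / q)"
proof (cases "w = 0 \<or> u = 0")
  case True
  have "0 < real l * k / q" using assms by simp
  then have "n > 0" using assms(9) by linarith
  then show ?thesis using True assms by (auto simp: zero_power)
next
  case False
  then have w: "w > 0" and u: "u > 0" using assms by auto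
  show ?thesis
  proof (cases "A \<le> e * w ^ l * u powr q")
    case True
    have "A * (w ^ n * u ^ k) \<le> (e * w ^ l * u powr q) * (w ^ n * u ^ k)"
      using True w u by (intro mult_right_mono) auto
    also have "\<dots> = e * w ^ (n + l) * (u ^ k * u powr q)"
      by (simp add: power_add)
    finally have "A * w ^ n * u ^ k \<le> e * w ^ (n + l) * (u ^ k * u powr q)" by (simp add: mult.assoc)
    moreover have "0 \<le> A * (A / e) powr (k / q)" using assms by simp
    ultimately show ?thesis by linarith
  next
    case False
    \<comment> \<open>The combination that failure of the first case bounds: its power
      \<open>q\<close> is \<open>w ^ l * u powr q\<close>, which is below
      \<open>A / e\<close>.\<close>
    define z where "z = w powr (l / q) * u"
    have z: "z > 0" using w u by (simp add: z_def)
    have "z powr q = w ^ l * u powr q"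
      using w u assms by (simp add: z_def powr_mult powr_powr powr_realpow)
    also have "\<dots> < A / e" using False assms by (simp add: field_simps)
    finally have "(z powr q) powr (k / q) \<le> (A / e) powr (k / q)"
      using assms by (intro powr_mono2) auto
    then have 1: "z ^ k \<le> (A / e) powr (k / q)"
      using assms z by (simp add: powr_powr powr_realpow)
    have "w ^ n = w powr n" using w by (simp add: powr_realpow)
    also have "\<dots> \<le> w powr (real l * k / q)" using assms by (intro powr_mono') auto
    also have "\<dots> = (w powr (l / q)) ^ k"
      using w by (simp add: powr_powr flip: powr_realpow)
    finally have "w ^ n * u ^ k \<le> z ^ k"
      using u by (simp add: z_def power_mult_distrib)
    with 1 have "A * (w ^ n * u ^ k) \<le> A * (A / e) powr (k / q)"
      using assms by (intro mult_left_mono) auto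
    moreover have "0 \<le> e * w ^ (n + l) * (u ^ k * u powr q)" using assms by simp
    ultimately show ?thesis by (simp add: mult.assoc)
  qed
qed

text \<open>The pointwise estimate is applied with \<open>A / R\<^sup>2\<close> in place of
  \<open>A\<close>. Its remainder, integrated over a ball of radius R, is a constant times R to the
  power \<open>r\<close>, and \<open>N\<close> says exactly that \<open>r < 0\<close>. The weight
  \<open>z\<close> lets the cutoff around the compact set pass through unchanged.\<close>

lemma bump_absorb:
  fixes u z :: "'a::euclidean_space \<Rightarrow> real" and q A e :: real and k l n :: nat
  assumes A: "A > 0" and e: "e > 0" and q: "q > 0" and kl: "k > 0" "l > 0" "real l * k / q \<le> n"
    and u: "continuous_on UNIV u" "\<And>x. u x \<ge> 0"
    and z: "continuous_on UNIV z" "\<And>x. z x \<ge> 0" "\<And>x. z x \<le> 1"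
    and N: "DIM('a) < 2 + 2 * k / q" and d: "d > 0"
  shows "\<forall>\<^sub>F R in at_top. (LINT x|lborel. A / R\<^sup>2 * bump R x ^ n * u x ^ k * z x)
     \<le> e * (LINT x|lborel. bump R x ^ (n + l) * (u x ^ k * u x powr q * z x)) + d"
proof -
  define V where "V = measure lborel (ball (0::'a) 1)"
  define r where "r = real DIM('a) - 2 - 2 * k / q"
  have "r < 0" using N by (simp add: r_def)
  then have "((\<lambda>R. A * (A / e) powr (k / q) * V * R powr r) \<longlongrightarrow> A * (A / e) powr (k / q) * V * 0) at_top"
    by (intro tendsto_mult_left tendsto_neg_powr filterlim_ident)
  then have "\<forall>\<^sub>F R in at_top. A * (A / e) powr (k / q) * V * R powr r < d"
    using d by (intro order_tendstoD) auto
  then have "\<forall>\<^sub>F R in at_top. R > 0 \<and> A * (A / e) powr (k / q) * V * R powr r < d"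
    using eventually_gt_at_top[of "0::real"] by eventually_elim auto
  then show ?thesis
  proof eventually_elim
    case (elim R)
    then have R: "R > 0" by simp
    have "0 < real l * k / q" using kl q by simp
    then have n: "n > 0" using kl(3) by linarith
    define B where "B = A / R\<^sup>2 * ((A / R\<^sup>2) / e) powr (k / q)"
    have E: "B * measure lborel (cball (0::'a) R) = A * (A / e) powr (k / q) * V * R powr r"
    proof -
      have "((A / R\<^sup>2) / e) powr (k / q) = (A / e * R powr (-2)) powr (k / q)"
        using R by (simp add: powr_minus powr_numeral field_simps)
      also have "\<dots> = (A / e) powr (k / q) * R powr (- 2 * (k / q))"
        using A e by (subst powr_mult) (auto simp: powr_powr)
      finally have 1: "((A / R\<^sup>2) / e) powr (k / q) = (A / e) powr (k / q) * R powr (- 2 * (k / q))" .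
      have "measure lborel (cball (0::'a) R) = R powr DIM('a) * V"
        using content_ball_conv_unit_ball[of R "0::'a"] R
        by (simp add: content_cball_conv_ball V_def powr_realpow)
      moreover have "A / R\<^sup>2 = A * R powr (-2)"
        using R by (simp add: powr_minus powr_numeral field_simps)
      moreover have "R powr r = R powr (-2) * R powr (- 2 * (k / q)) * R powr DIM('a)"
        by (simp add: r_def algebra_simps flip: powr_add)
      ultimately show ?thesis unfolding B_def 1 by simp
    qed
    have B: "B \<ge> 0" using A e by (simp add: B_def)
    have i: "integrable lborel (\<lambda>x. bump R x ^ (n + l) * (u x ^ k * u x powr q * z x))"
      by (rule integrable_bump) (use R n q u z in \<open>auto intro!: continuous_intros continuous_on_powr'\<close>)
    have ib: "integrable lborel (\<lambda>x. B * indicator (cball (0::'a) R) x)"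
      using emeasure_lborel_cball_finite[of "0::'a" R]
      by (intro integrable_mult_right integrable_real_indicator) auto
    have il: "integrable lborel (\<lambda>x. bump R x ^ n * (A / R\<^sup>2 * u x ^ k * z x))"
      by (rule integrable_bump) (use R n u z in \<open>auto intro!: continuous_intros\<close>)
    have "(LINT x|lborel. A / R\<^sup>2 * bump R x ^ n * u x ^ k * z x)
      \<le> (LINT x|lborel. e * (bump R x ^ (n + l) * (u x ^ k * u x powr q * z x)) + B * indicator (cball 0 R) x)"
    proof (rule integral_mono)
      show "integrable lborel (\<lambda>x. A / R\<^sup>2 * bump R x ^ n * u x ^ k * z x)"
        using il by (simp add: mult_ac)
      show "integrable lborel (\<lambda>x. e * (bump R x ^ (n + l) * (u x ^ k * u x powr q * z x)) + B * indicator (cball 0 R) x)"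
        by (intro Bochner_Integration.integrable_add integrable_mult_right i ib)
      fix x :: 'a
      show "A / R\<^sup>2 * bump R x ^ n * u x ^ k * z x
        \<le> e * (bump R x ^ (n + l) * (u x ^ k * u x powr q * z x)) + B * indicator (cball 0 R) x"
      proof (cases "x \<in> cball 0 R")
        case True
        have "(A / R\<^sup>2 * bump R x ^ n * u x ^ k) * z x
           \<le> (e * bump R x ^ (n + l) * (u x ^ k * u x powr q) + B) * z x"
          unfolding B_def using A e q R kl u z
          by (intro mult_right_mono young_absorb) (auto simp: bump_nonneg bump_le_1)
        moreover have "B * z x \<le> B * 1" using B z by (intro mult_left_mono) auto
        ultimately show ?thesis using True by (simp add: algebra_simps)
      next
        case False
        then show ?thesis using bump_eq_0[OF R, of x] n by (simp add: zero_power)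
      qed
    qed
    also have "\<dots> = e * (LINT x|lborel. bump R x ^ (n + l) * (u x ^ k * u x powr q * z x)) + B * measure lborel (cball (0::'a) R)"
      using i ib by simp
    also have "\<dots> \<le> e * (LINT x|lborel. bump R x ^ (n + l) * (u x ^ k * u x powr q * z x)) + d"
      using elim E by simp
    finally show ?case .
  qed
qed

section \<open>Serrin range and Caccioppoli identity\<close>

lemma has_hessian_half_square:
  assumes "has_hessian u G H"
  shows "has_hessian (\<lambda>x. (u x)\<^sup>2 / 2) (\<lambda>x. u x *\<^sub>R G x) (\<lambda>x h. (G x \<bullet> h) *\<^sub>R G x + u x *\<^sub>R H x h)"
  unfolding has_hessian_def
proof (intro conjI allI)
  note d = has_hessianD[OF assms]
  show "((\<lambda>x. (u x)\<^sup>2 / 2) has_derivative (\<bullet>) (u x *\<^sub>R G x)) (at x)" for x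
    by (rule has_derivative_eq_rhs[OF has_derivative_divide[OF has_derivative_power[OF d(1)] has_derivative_const]])
       (simp_all add: fun_eq_iff)
  show "((\<lambda>x. u x *\<^sub>R G x) has_derivative (\<lambda>h. (G x \<bullet> h) *\<^sub>R G x + u x *\<^sub>R H x h)) (at x)" for x
    by (rule has_derivative_eq_rhs[OF has_derivative_scaleR[OF d(1,2)]]) (simp add: fun_eq_iff)
  show "continuous_on UNIV (\<lambda>x. (G x \<bullet> h) *\<^sub>R G x + u x *\<^sub>R H x h)" for h
    by (intro continuous_intros d)
qed

text \<open>Testing with \<open>bump R x ^ n\<close> bounds the truncated integral of
  \<open>h\<close> by half of itself plus an arbitrarily small \<open>d / 2\<close>: the cutoff
  Laplacian is absorbed into u^(1 + q), hence into \<open>h\<close>. So the integral of the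
  nonnegative \<open>h\<close> is 0.\<close>

lemma liouville_serrin_range:
  fixes u h :: "'a::euclidean_space \<Rightarrow> real"
  assumes u: "has_hessian u G H" "\<And>x. u x \<ge> 0"
    and eq: "\<And>x. - (\<Sum>b\<in>Basis. H x b \<bullet> b) = h x" and h: "continuous_on UNIV h"
    and c: "c > 0" and q: "q > 0" and le: "\<And>x. c * (u x * u x powr q) \<le> h x"
    and N: "DIM('a) < 2 + 2 / q"
  shows "h x = 0"
proof -
  have cu: "continuous_on UNIV u" by (rule has_hessianD[OF u(1)])
  have h0: "h x \<ge> 0" for x
    by (rule order_trans[OF _ le]) (use c u in auto)
  \<comment> \<open>The summand 3 gives the cutoff a Hessian; the rest is the exponent condition of
    the absorption with k = l = 1.\<close>
  define n where "n = nat \<lceil>1 / q\<rceil> + 3"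
  have n: "3 \<le> n" "1 / q \<le> real (n - 1)" by (auto simp: n_def) linarith
  have "\<forall>\<^sub>F R in at_top. (LINT x|lborel. bump R x ^ n * h x) \<le> d" if d: "d > 0" for d
  proof -
    have "\<forall>\<^sub>F R in at_top. (LINT x|lborel. (2 * n * DIM('a)) / R\<^sup>2 * bump R x ^ (n - 1) * u x ^ 1 * 1)
     \<le> c / 2 * (LINT x|lborel. bump R x ^ (n - 1 + 1) * (u x ^ 1 * u x powr q * 1)) + d / 2"
      by (rule bump_absorb) (use c q n N d u cu in auto)
    moreover have "\<forall>\<^sub>F R in at_top. (R::real) > 0" by (rule eventually_gt_at_top)
    ultimately show ?thesis
    proof eventually_elim
      case (elim R)
      have "(LINT x|lborel. bump R x ^ n * h x) = - (LINT x|lborel. bump R x ^ n * (\<Sum>b\<in>Basis. H x b \<bullet> b))"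
        by (simp flip: eq)
      also have "\<dots> \<le> (LINT x|lborel. (2 * n * DIM('a)) / R\<^sup>2 * bump R x ^ (n - 1) * u x)"
        using integral_bump_laplacian(1)[OF u(1) u(2) elim(2) n(1)] by simp
      also have "\<dots> \<le> c / 2 * (LINT x|lborel. bump R x ^ n * (u x * u x powr q)) + d / 2"
        using elim(1) n(1) by simp
      also have "c / 2 * (LINT x|lborel. bump R x ^ n * (u x * u x powr q))
         = (LINT x|lborel. c / 2 * (bump R x ^ n * (u x * u x powr q)))"
        by simp
      also have "\<dots> \<le> (LINT x|lborel. 1 / 2 * (bump R x ^ n * h x))"
      proof (rule integral_mono)
        show "integrable lborel (\<lambda>x. c / 2 * (bump R x ^ n * (u x * u x powr q)))"
          by (intro integrable_mult_right integrable_bump)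
             (use elim n cu u q in \<open>auto intro!: continuous_intros continuous_on_powr'\<close>)
        show "integrable lborel (\<lambda>x. 1 / 2 * (bump R x ^ n * h x))"
          by (intro integrable_mult_right integrable_bump) (use elim n h in auto)
        show "c / 2 * (bump R x ^ n * (u x * u x powr q)) \<le> 1 / 2 * (bump R x ^ n * h x)" for x
          using mult_left_mono[OF le, of "bump R x ^ n / 2" x] bump_nonneg[of R x]
          by (simp add: mult_ac)
      qed
      also have "\<dots> = 1 / 2 * (LINT x|lborel. bump R x ^ n * h x)" by simp
      finally show ?case by simp
    qed
  qed
  then have "integrable lborel h \<and> (LINT x|lborel. h x) \<le> d" if "d > 0" for d
    using bump_integral_criterion[OF h h0, of n d] n that by auto
  then show ?thesis
    using continuous_nonneg_integral_0[OF h h0] field_le_epsilon[of "LINT x|lborel. h x" 0]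
    by (metis add_0 zero_less_one)
qed

section \<open>Radial cutoffs away from a ball, and the Caccioppoli identity\<close>

text \<open>The squared positive part is C1, unlike the positive part itself.\<close>

definition exterior_cutoff :: "real \<Rightarrow> 'a::euclidean_space \<Rightarrow> real" where
  "exterior_cutoff r x = 1 - (max 0 (1 - (max 0 (x \<bullet> x - r\<^sup>2))\<^sup>2))\<^sup>2"

definition exterior_cutoff_grad :: "real \<Rightarrow> 'a::euclidean_space \<Rightarrow> 'a" where
  "exterior_cutoff_grad r x =
     (8 * max 0 (1 - (max 0 (x \<bullet> x - r\<^sup>2))\<^sup>2) * max 0 (x \<bullet> x - r\<^sup>2)) *\<^sub>R x"

lemma exterior_cutoff_derivative:
  "(exterior_cutoff r has_derivative (\<lambda>h. exterior_cutoff_grad r x \<bullet> h)) (at x)"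
proof -
  have sq: "((\<lambda>t::real. (max 0 t)\<^sup>2) has_derivative (\<lambda>d. 2 * max 0 t * d)) (at t)" for t
    using max_power_deriv[of 2 t] by (simp add: has_field_derivative_def)
  have 1: "((\<lambda>x. x \<bullet> x - r\<^sup>2) has_derivative (\<lambda>h. 2 * (x \<bullet> h))) (at x)" for x :: 'a
    by (auto intro!: derivative_eq_intros simp: inner_commute)
  have 2: "((\<lambda>x. 1 - (max 0 (x \<bullet> x - r\<^sup>2))\<^sup>2) has_derivative
     (\<lambda>h. 0 - 2 * max 0 (x \<bullet> x - r\<^sup>2) * (2 * (x \<bullet> h)))) (at x)" for x :: 'a
    by (rule has_derivative_diff[OF has_derivative_const has_derivative_compose[OF 1 sq]])
  show ?thesis unfolding exterior_cutoff_def[abs_def]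
    by (rule has_derivative_eq_rhs[OF has_derivative_diff[OF has_derivative_const has_derivative_compose[OF 2 sq]]])
       (simp add: exterior_cutoff_grad_def fun_eq_iff)
qed

lemma continuous_on_exterior_cutoff_grad: "continuous_on S (exterior_cutoff_grad r)"
  unfolding exterior_cutoff_grad_def[abs_def] by (intro continuous_intros)

lemma continuous_on_exterior_cutoff: "continuous_on S (exterior_cutoff r)"
  unfolding exterior_cutoff_def[abs_def] by (intro continuous_intros)

lemma exterior_cutoff_bounds: "0 \<le> exterior_cutoff r x" "exterior_cutoff r x \<le> 1"
  by (auto simp: exterior_cutoff_def power_le_one_iff)

lemma exterior_cutoff_inner:
  assumes "norm x < r"
  shows "exterior_cutoff r x = 0"
proof -
  have "x \<bullet> x < r\<^sup>2"
    using assms by (simp add: power2_norm_eq_inner[symmetric] power_strict_mono)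
  then show ?thesis by (simp add: exterior_cutoff_def)
qed

lemma exterior_cutoff_outer:
  assumes "r \<ge> 0" "norm x > r + 1"
  shows "exterior_cutoff r x = 1" "exterior_cutoff_grad r x = 0"
proof -
  have "(r + 1)\<^sup>2 < x \<bullet> x"
    using assms by (simp add: power2_norm_eq_inner[symmetric] power_strict_mono)
  \<comment> \<open>The transition from 0 to 1 takes place while \<open>x \<bullet> x\<close> grows
    from r^2 to r^2 + 1, so it is complete before \<open>norm x\<close> reaches r + 1.\<close>
  moreover have "r\<^sup>2 + 1 \<le> (r + 1)\<^sup>2" using assms by (simp add: power2_eq_square algebra_simps)
  ultimately have "1 \<le> max 0 (x \<bullet> x - r\<^sup>2)" by simp
  then have "1 \<le> (max 0 (x \<bullet> x - r\<^sup>2))\<^sup>2" by (rule one_le_power)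
  then show "exterior_cutoff r x = 1" "exterior_cutoff_grad r x = 0"
    by (auto simp: exterior_cutoff_def exterior_cutoff_grad_def)
qed

text \<open>Testing stability with u psi and the equation with u psi squared cancels every term
  that contains the gradient of u.\<close>

lemma caccioppoli_identity:
  fixes u h p :: "'a::euclidean_space \<Rightarrow> real"
  assumes u: "has_hessian u G H"
    and eq: "\<And>x. - (\<Sum>b\<in>Basis. H x b \<bullet> b) = h x"
    and p: "\<And>x. (p has_derivative (\<lambda>h. P x \<bullet> h)) (at x)" "continuous_on UNIV P"
    and z: "\<And>x. norm x > R \<Longrightarrow> p x = 0" "\<And>x. norm x > R \<Longrightarrow> P x = 0"
  shows "(LINT x|lborel. (norm (u x *\<^sub>R P x + p x *\<^sub>R G x))\<^sup>2)
     = (LINT x|lborel. u x * h x * (p x)\<^sup>2 + (u x)\<^sup>2 * (norm (P x))\<^sup>2)"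
proof -
  note d = has_hessianD[OF u]
  have cp: "continuous_on UNIV p"
    by (rule has_derivative_continuous_on[OF has_derivative_at_withinI[OF p(1)]])
  define D where "D x e = ((G x \<bullet> e) * (p x)\<^sup>2 + u x * (2 * p x * (P x \<bullet> e))) *\<^sub>R G x + (u x * (p x)\<^sup>2) *\<^sub>R H x e" for x e
  have "(LINT x|lborel. (\<Sum>b\<in>Basis. D x b \<bullet> b)) = 0"
  proof (rule integral_divergence_eq_0)
    have "((\<lambda>x. u x * (p x)\<^sup>2) has_derivative (\<lambda>e. (G x \<bullet> e) * (p x)\<^sup>2 + u x * (2 * p x * (P x \<bullet> e)))) (at x)" for x
      by (rule has_derivative_eq_rhs[OF has_derivative_mult[OF d(1) has_derivative_power[OF p(1)]]])
         (simp add: fun_eq_iff)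
    then show "((\<lambda>x. (u x * (p x)\<^sup>2) *\<^sub>R G x) has_derivative D x) (at x)" for x
      unfolding D_def by (rule has_derivative_eq_rhs[OF has_derivative_scaleR[OF _ d(2)]]) (simp add: fun_eq_iff)
    show "continuous_on UNIV (\<lambda>x. D x b)" for b
      unfolding D_def by (intro continuous_intros d cp p)
    show "norm x > R \<Longrightarrow> (u x * (p x)\<^sup>2) *\<^sub>R G x = 0" for x
      using z by simp
  qed
  \<comment> \<open>\<open>D\<close> differentiates the field u p^2 G. Its cross term 2 u p (P
    \<bullet> G) is the one in the expanded square, so completing the square leaves only terms
    without \<open>G\<close>.\<close>
  moreover have "(\<Sum>b\<in>Basis. D x b \<bullet> b)
     = (norm (u x *\<^sub>R P x + p x *\<^sub>R G x))\<^sup>2 - (u x * h x * (p x)\<^sup>2 + (u x)\<^sup>2 * (norm (P x))\<^sup>2)" for x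
  proof -
    have "(\<Sum>b\<in>Basis. D x b \<bullet> b) = (p x)\<^sup>2 * (\<Sum>b\<in>Basis. (G x \<bullet> b) * (G x \<bullet> b))
       + 2 * u x * p x * (\<Sum>b\<in>Basis. (P x \<bullet> b) * (G x \<bullet> b)) + u x * (p x)\<^sup>2 * (\<Sum>b\<in>Basis. H x b \<bullet> b)"
      by (simp add: D_def inner_add_left sum.distrib sum_distrib_left algebra_simps)
    also have "\<dots> = (p x)\<^sup>2 * (G x \<bullet> G x) + 2 * u x * p x * (P x \<bullet> G x) - u x * (p x)\<^sup>2 * h x"
      by (simp flip: eq euclidean_inner)
    also have "\<dots> = (norm (u x *\<^sub>R P x + p x *\<^sub>R G x))\<^sup>2 - (u x * h x * (p x)\<^sup>2 + (u x)\<^sup>2 * (norm (P x))\<^sup>2)"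
      unfolding power2_norm_eq_inner
      by (simp add: inner_add_left inner_add_right inner_commute power2_eq_square algebra_simps)
    finally show ?thesis .
  qed
  moreover have "continuous_on UNIV h"
    unfolding eq[symmetric] by (intro continuous_intros continuous_on_trace[OF u])
  then have "(LINT x|lborel. (norm (u x *\<^sub>R P x + p x *\<^sub>R G x))\<^sup>2 - (u x * h x * (p x)\<^sup>2 + (u x)\<^sup>2 * (norm (P x))\<^sup>2))
    = (LINT x|lborel. (norm (u x *\<^sub>R P x + p x *\<^sub>R G x))\<^sup>2) - (LINT x|lborel. u x * h x * (p x)\<^sup>2 + (u x)\<^sup>2 * (norm (P x))\<^sup>2)"
    by (intro Bochner_Integration.integral_diff integrable_compact_support[where R = R]
         continuous_intros cp d p) (auto simp: z)
  ultimately show ?thesis by simp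
qed

section \<open>Finite energy and the Pohozaev identity\<close>

lemma norm_add_squared_le:
  fixes a b :: "'a::real_inner"
  shows "(norm (a + b))\<^sup>2 \<le> 2 * (norm a)\<^sup>2 + 2 * (norm b)\<^sup>2"
proof -
  have "0 \<le> (norm (a - b))\<^sup>2" by simp
  then show ?thesis
    unfolding power2_norm_eq_inner by (simp add: inner_add_left inner_add_right inner_diff_left inner_diff_right inner_commute)
qed

text \<open>\<open>D\<close> stands for f'(u) u^2, and the test function is p = bump^m z with z
  vanishing near the compact set. The gradient of z contributes a constant independent of R; that of
  bump^m is absorbed into half of the surplus \<open>d\<close> times the energy. This leaves a bound
  uniform in R.\<close>

lemma stable_finite_energy:
  fixes u h D :: "'a::euclidean_space \<Rightarrow> real"
  assumes u: "has_hessian u G H" "\<And>x. u x \<ge> 0"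
    and eq: "\<And>x. - (\<Sum>b\<in>Basis. H x b \<bullet> b) = h x" 
    and c: "c > 0" and q: "q > 0" and le: "\<And>x. c * ((u x)\<^sup>2 * u x powr q) \<le> u x * h x"
    and N: "DIM('a) < 2 + 4 / q"
    and d: "d > 0" and D: "continuous_on UNIV D" "\<And>x. (1 + d) * (u x * h x) \<le> D x"
    and r: "r \<ge> 0"
    and stab: "\<And>p P R. (\<And>x. (p has_derivative (\<lambda>e. P x \<bullet> e)) (at x)) \<Longrightarrow> continuous_on UNIV P \<Longrightarrow>
        (\<And>x. norm x > R \<Longrightarrow> p x = 0) \<Longrightarrow> (\<And>x. norm x < r \<Longrightarrow> p x = 0) \<Longrightarrow>
        (LINT x|lborel. D x * (p x)\<^sup>2) \<le> (LINT x|lborel. (norm (u x *\<^sub>R P x + p x *\<^sub>R G x))\<^sup>2)"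
  shows "integrable lborel (\<lambda>x. u x * h x)"
proof -
  note du = has_hessianD[OF u(1)]
  have ch: "continuous_on UNIV h"
    unfolding eq[symmetric] by (intro continuous_intros continuous_on_trace[OF u(1)])
  have uh: "u x * h x \<ge> 0" for x
    by (rule order_trans[OF _ le]) (use c u in auto)
  define z where "z = (exterior_cutoff r :: 'a \<Rightarrow> real)"
  define Z where "Z = (exterior_cutoff_grad r :: 'a \<Rightarrow> 'a)"
  have z: "(z has_derivative (\<lambda>e. Z x \<bullet> e)) (at x)" "0 \<le> z x" "z x \<le> 1" for x
    unfolding z_def Z_def by (rule exterior_cutoff_derivative exterior_cutoff_bounds)+
  have cz: "continuous_on UNIV z" "continuous_on UNIV Z"
    unfolding z_def Z_def by (rule continuous_on_exterior_cutoff continuous_on_exterior_cutoff_grad)+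
  have zo: "z x = 1" "Z x = 0" if "norm x > r + 1" for x
    using exterior_cutoff_outer[OF r that] by (auto simp: z_def Z_def)
  \<comment> \<open>\<open>m \<ge> 2\<close> makes bump^m a C1 function;
    \<open>2 / q \<le> m - 1\<close> is the absorption condition with k = l = 2 and exponent 2 (m -
    1).\<close>
  define m where "m = nat \<lceil>2 / q\<rceil> + 2"
  have m: "2 \<le> m" "2 / q \<le> real (m - 1)" by (auto simp: m_def) linarith
  have iZ: "integrable lborel (\<lambda>x. 2 * ((u x)\<^sup>2 * (norm (Z x))\<^sup>2))"
    by (rule integrable_compact_support[where R = "r + 1"])
       (auto intro!: continuous_intros du cz simp: zo)
  define C where "C = (LINT x|lborel. 2 * ((u x)\<^sup>2 * (norm (Z x))\<^sup>2))"
  \<comment> \<open>The gradient of bump^m is at most 2m/R times bump^(m - 1); its square gives 4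
    m^2, and splitting the square of a sum doubles it.\<close>
  define A where "A = 8 * (real m)\<^sup>2"
  have "\<forall>\<^sub>F R in at_top. (LINT x|lborel. A / R\<^sup>2 * bump R x ^ (2 * (m - 1)) * u x ^ 2 * (z x)\<^sup>2)
     \<le> c * d / 2 * (LINT x|lborel. bump R x ^ (2 * (m - 1) + 2) * (u x ^ 2 * u x powr q * (z x)\<^sup>2)) + 1"
  proof (rule bump_absorb)
    show "real 2 * real 2 / q \<le> real (2 * (m - 1))" using m(2) by simp
  qed (use c d q m(1) N u du cz z in \<open>auto intro!: continuous_intros power_le_one simp: A_def\<close>)
  moreover have "\<forall>\<^sub>F R in at_top. (R::real) > 0" by (rule eventually_gt_at_top)
  ultimately have ev: "\<forall>\<^sub>F R in at_top. (LINT x|lborel. bump R x ^ (2 * m) * (u x * h x * (z x)\<^sup>2)) \<le> 2 * (C + 1) / d"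
  proof eventually_elim
    case (elim R)
    note R = elim(2)
    define p where "p x = bump R x ^ m * z x" for x
    define B where "B x = (- (2 * real m / R\<^sup>2) * bump R x ^ (m - 1)) *\<^sub>R x" for x :: 'a
    define P where "P x = bump R x ^ m *\<^sub>R Z x + z x *\<^sub>R B x" for x
    have p: "(p has_derivative (\<lambda>e. P x \<bullet> e)) (at x)" for x
      unfolding p_def
      by (rule has_derivative_eq_rhs[OF has_derivative_mult[OF bump_power_derivative[OF m(1)] z(1)]])
         (simp add: fun_eq_iff P_def B_def inner_add_left inner_diff_left algebra_simps)
    have cP: "continuous_on UNIV P" and cp: "continuous_on UNIV p"
      unfolding P_def p_def B_def by (intro continuous_intros cz)+
    have m0: "m > 0" "m - 1 > 0" "m - Suc 0 > 0" using m by auto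
    have po: "p x = 0" "P x = 0" if "norm x > R" for x
      using bump_eq_0[OF R that] m0 by (auto simp: p_def P_def B_def zero_power)
    have pi: "p x = 0" if "norm x < r" for x
      using exterior_cutoff_inner[OF that] by (simp add: p_def z_def)
    have pp: "(p x)\<^sup>2 = bump R x ^ (2 * m) * (z x)\<^sup>2" for x
      by (simp add: p_def power_mult_distrib power_even_eq)
    have iuhp: "integrable lborel (\<lambda>x. u x * h x * (p x)\<^sup>2)"
      by (rule integrable_compact_support[where R = R])
         (auto intro!: continuous_intros du ch cp simp: po)
    have iuP: "integrable lborel (\<lambda>x. (u x)\<^sup>2 * (norm (P x))\<^sup>2)"
      by (rule integrable_compact_support[where R = R])
         (auto intro!: continuous_intros du cP simp: po)
    have iDp: "integrable lborel (\<lambda>x. D x * (p x)\<^sup>2)"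
      by (rule integrable_compact_support[where R = R])
         (auto intro!: continuous_intros D cp simp: po)
    have iA: "integrable lborel (\<lambda>x. A / R\<^sup>2 * bump R x ^ (2 * (m - 1)) * u x ^ 2 * (z x)\<^sup>2)"
      by (rule integrable_compact_support[where R = R])
         (use R m0 bump_eq_0[OF R] in \<open>auto intro!: continuous_intros du cz simp: zero_power\<close>)
    define I where "I = (LINT x|lborel. u x * h x * (p x)\<^sup>2)"
    have "(1 + d) * I = (LINT x|lborel. (1 + d) * (u x * h x * (p x)\<^sup>2))"
      by (simp add: I_def)
    also have "\<dots> \<le> (LINT x|lborel. D x * (p x)\<^sup>2)"
    proof (rule integral_mono)
      show "(1 + d) * (u x * h x * (p x)\<^sup>2) \<le> D x * (p x)\<^sup>2" for x
        using mult_right_mono[OF D(2)[of x], of "(p x)\<^sup>2"] by (simp add: mult.assoc)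
    qed (use iuhp iDp in auto)
    also have "\<dots> \<le> (LINT x|lborel. (norm (u x *\<^sub>R P x + p x *\<^sub>R G x))\<^sup>2)"
      by (rule stab[OF p cP po(1) pi])
    \<comment> \<open>The identity returns one full copy of \<open>I\<close>, so only the surplus
      \<open>d * I\<close> survives on the left.\<close>
    also have "\<dots> = I + (LINT x|lborel. (u x)\<^sup>2 * (norm (P x))\<^sup>2)"
      using iuhp iuP by (simp add: I_def caccioppoli_identity[OF u(1) eq p cP po])
    finally have "d * I \<le> (LINT x|lborel. (u x)\<^sup>2 * (norm (P x))\<^sup>2)"
      by (simp add: algebra_simps)
    also have "\<dots> \<le> (LINT x|lborel. 2 * ((u x)\<^sup>2 * (norm (Z x))\<^sup>2) + A / R\<^sup>2 * bump R x ^ (2 * (m - 1)) * u x ^ 2 * (z x)\<^sup>2)"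
    proof (rule integral_mono[OF iuP Bochner_Integration.integrable_add[OF iZ iA]])
      fix x
      have "(norm (bump R x ^ m *\<^sub>R Z x))\<^sup>2 \<le> (norm (Z x))\<^sup>2"
        by (intro power_mono) (auto simp: bump_nonneg bump_le_1 power_le_one intro!: mult_left_le_one_le)
      moreover have "2 * (norm (z x *\<^sub>R B x))\<^sup>2 \<le> A / R\<^sup>2 * bump R x ^ (2 * (m - 1)) * (z x)\<^sup>2"
      proof -
        have "(norm (B x))\<^sup>2 = (2 * real m / R\<^sup>2 * bump R x ^ (m - 1))\<^sup>2 * (x \<bullet> x)"
          unfolding power2_norm_eq_inner B_def by (simp add: power2_eq_square)
        also have "\<dots> \<le> (2 * real m / R\<^sup>2 * bump R x ^ (m - 1))\<^sup>2 * R\<^sup>2"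
        proof (cases "bump R x = 0")
          case True
          then show ?thesis using m0 by (simp add: zero_power)
        next
          case False
          then show ?thesis using bump_nonzeroD[OF R] by (intro mult_left_mono) auto
        qed
        also have "\<dots> = A / (2 * R\<^sup>2) * bump R x ^ (2 * (m - 1))"
          using R by (simp add: A_def power_mult_distrib power_divide power_even_eq field_simps)
        finally have "(norm (B x))\<^sup>2 \<le> A / (2 * R\<^sup>2) * bump R x ^ (2 * (m - 1))" .
        from mult_right_mono[OF this, of "2 * (z x)\<^sup>2"] show ?thesis
          by (simp add: power_mult_distrib mult_ac)
      qed
      ultimately have "(norm (P x))\<^sup>2 \<le> 2 * (norm (Z x))\<^sup>2 + A / R\<^sup>2 * bump R x ^ (2 * (m - 1)) * (z x)\<^sup>2"
        using norm_add_squared_le[of "bump R x ^ m *\<^sub>R Z x" "z x *\<^sub>R B x"] unfolding P_def by linarith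
      then have "(u x)\<^sup>2 * (norm (P x))\<^sup>2 \<le> (u x)\<^sup>2 * (2 * (norm (Z x))\<^sup>2 + A / R\<^sup>2 * bump R x ^ (2 * (m - 1)) * (z x)\<^sup>2)"
        by (intro mult_left_mono) auto
      then show "(u x)\<^sup>2 * (norm (P x))\<^sup>2 \<le> 2 * ((u x)\<^sup>2 * (norm (Z x))\<^sup>2) + A / R\<^sup>2 * bump R x ^ (2 * (m - 1)) * u x ^ 2 * (z x)\<^sup>2"
        by (simp add: algebra_simps)
    qed
    also have "\<dots> = C + (LINT x|lborel. A / R\<^sup>2 * bump R x ^ (2 * (m - 1)) * u x ^ 2 * (z x)\<^sup>2)"
      unfolding C_def by (rule Bochner_Integration.integral_add[OF iZ iA])
    also have "\<dots> \<le> C + (c * d / 2 * (LINT x|lborel. bump R x ^ (2 * (m - 1) + 2) * (u x ^ 2 * u x powr q * (z x)\<^sup>2)) + 1)"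
      using elim(1) by simp
    also have "2 * (m - 1) + 2 = 2 * m" using m by simp
    also have "c * d / 2 * (LINT x|lborel. bump R x ^ (2 * m) * (u x ^ 2 * u x powr q * (z x)\<^sup>2))
        = (LINT x|lborel. c * d / 2 * (bump R x ^ (2 * m) * (u x ^ 2 * u x powr q * (z x)\<^sup>2)))"
      by simp
    also have "\<dots> \<le> (LINT x|lborel. d / 2 * (u x * h x * (p x)\<^sup>2))"
    proof (rule integral_mono)
      show "integrable lborel (\<lambda>x. c * d / 2 * (bump R x ^ (2 * m) * (u x ^ 2 * u x powr q * (z x)\<^sup>2)))"
        by (intro integrable_mult_right integrable_bump)
           (use R m0 du u q cz in \<open>auto intro!: continuous_intros continuous_on_powr'\<close>)
      show "integrable lborel (\<lambda>x. d / 2 * (u x * h x * (p x)\<^sup>2))"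
        using iuhp by simp
      show "c * d / 2 * (bump R x ^ (2 * m) * (u x ^ 2 * u x powr q * (z x)\<^sup>2)) \<le> d / 2 * (u x * h x * (p x)\<^sup>2)" for x
      proof -
        have "0 \<le> d / 2 * (p x)\<^sup>2" using d by simp
        from mult_left_mono[OF le[of x] this] show ?thesis by (simp add: pp mult_ac)
      qed
    qed
    also have "\<dots> = d / 2 * I" by (simp add: I_def)
    finally have "I \<le> 2 * (C + 1) / d" using d by (simp add: field_simps)
    then show ?case by (simp add: I_def pp mult_ac)
  qed
  have "integrable lborel (\<lambda>x. u x * h x * (z x)\<^sup>2)"
    by (rule bump_integral_criterion(1)[OF _ _ _ ev])
       (use uh m in \<open>auto intro!: continuous_intros du ch cz\<close>)
  \<comment> \<open>Stability says nothing near the compact set, but there the remaining integrand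
    is continuous with compact support.\<close>
  moreover have "integrable lborel (\<lambda>x. u x * h x * (1 - (z x)\<^sup>2))"
    by (rule integrable_compact_support[where R = "r + 1"])
       (auto intro!: continuous_intros du ch cz simp: zo)
  ultimately have "integrable lborel (\<lambda>x. u x * h x * (z x)\<^sup>2 + u x * h x * (1 - (z x)\<^sup>2))"
    by (rule Bochner_Integration.integrable_add)
  then show ?thesis by (simp add: algebra_simps)
qed

text \<open>The Laplacian of u^2/2 is |grad u|^2 - u h. Testing it with bump^n leaves only the
  Laplacian of the cutoff against u^2, which is absorbed into u h with an arbitrarily small factor.
  The one-sided comparison of the two energies is the direction in which the Pohozaev identity is
  later used.\<close>

lemma finite_energy_gradient:
  fixes u h :: "'a::euclidean_space \<Rightarrow> real"
  assumes u: "has_hessian u G H" "\<And>x. u x \<ge> 0"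
    and eq: "\<And>x. - (\<Sum>b\<in>Basis. H x b \<bullet> b) = h x" 
    and c: "c > 0" and q: "q > 0" and le: "\<And>x. c * ((u x)\<^sup>2 * u x powr q) \<le> u x * h x"
    and N: "DIM('a) < 2 + 4 / q"
    and int: "integrable lborel (\<lambda>x. u x * h x)"
  shows "integrable lborel (\<lambda>x. G x \<bullet> G x)"
    "(LINT x|lborel. G x \<bullet> G x) \<le> (LINT x|lborel. u x * h x)"
proof -
  note du = has_hessianD[OF u(1)]
  have ch: "continuous_on UNIV h"
    unfolding eq[symmetric] by (intro continuous_intros continuous_on_trace[OF u(1)])
  have uh: "u x * h x \<ge> 0" for x
    by (rule order_trans[OF _ le]) (use c u in auto)
  define I where "I = (LINT x|lborel. u x * h x)"
  have I: "I \<ge> 0" unfolding I_def using uh by (simp add: integral_nonneg_AE)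
  \<comment> \<open>\<open>4 / q \<le> n - 2\<close> is the absorption condition with k = l = 2: two
    derivatives lower the exponent of the cutoff to \<open>n - 2\<close>.\<close>
  define n where "n = nat \<lceil>4 / q\<rceil> + 3"
  have n: "3 \<le> n" "4 / q \<le> real (n - 2)" by (auto simp: n_def) linarith
  have n0: "n > 0" "n - 2 > 0" and n2: "n - 2 + 2 = n" using n by auto
  have cG: "continuous_on UNIV (\<lambda>x. G x \<bullet> G x)" by (intro continuous_intros du)
  have ev: "\<forall>\<^sub>F R in at_top. (LINT x|lborel. bump R x ^ n * (G x \<bullet> G x)) \<le> I + d * (I + 1)" if d: "d > 0" for d
  proof -
    have "\<forall>\<^sub>F R in at_top. (LINT x|lborel. (2 * real n * real (n - 1)) / R\<^sup>2 * bump R x ^ (n - 2) * u x ^ 2 * 1)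
     \<le> c * d * (LINT x|lborel. bump R x ^ (n - 2 + 2) * (u x ^ 2 * u x powr q * 1)) + d"
      by (rule bump_absorb) (use c q n N d u du in auto)
    moreover have "\<forall>\<^sub>F R in at_top. (R::real) > 0" by (rule eventually_gt_at_top)
    ultimately show ?thesis
    proof eventually_elim
      case (elim R)
      note R = elim(2)
      have iG: "integrable lborel (\<lambda>x. bump R x ^ n * (G x \<bullet> G x))"
        by (rule integrable_bump[OF R n0(1) cG])
      have iuh: "integrable lborel (\<lambda>x. bump R x ^ n * (u x * h x))"
        by (intro integrable_bump R n0 continuous_intros du ch)
      have le_uh: "bump R x ^ n * (u x * h x) \<le> u x * h x" for x
        using uh by (intro mult_left_le_one_le power_le_one) (auto simp: bump_nonneg bump_le_1)
      have "(LINT x|lborel. bump R x ^ n * (G x \<bullet> G x)) - (LINT x|lborel. bump R x ^ n * (u x * h x))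
        = (LINT x|lborel. bump R x ^ n * (G x \<bullet> G x) - bump R x ^ n * (u x * h x))"
        using iG iuh by simp
      also have "\<dots> = (LINT x|lborel. bump R x ^ n * (\<Sum>b\<in>Basis. ((G x \<bullet> b) *\<^sub>R G x + u x *\<^sub>R H x b) \<bullet> b))"
      proof (rule Bochner_Integration.integral_cong[OF refl])
        fix x
        have "(\<Sum>b\<in>Basis. ((G x \<bullet> b) *\<^sub>R G x + u x *\<^sub>R H x b) \<bullet> b) = G x \<bullet> G x + u x * (\<Sum>b\<in>Basis. H x b \<bullet> b)"
          by (simp add: inner_add_left sum.distrib sum_distrib_left euclidean_inner[of "G x" "G x"])
        also have "(\<Sum>b\<in>Basis. H x b \<bullet> b) = - h x" by (simp flip: eq)
        finally have *: "(\<Sum>b\<in>Basis. ((G x \<bullet> b) *\<^sub>R G x + u x *\<^sub>R H x b) \<bullet> b) = G x \<bullet> G x + u x * - h x" .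
        show "bump R x ^ n * (G x \<bullet> G x) - bump R x ^ n * (u x * h x)
          = bump R x ^ n * (\<Sum>b\<in>Basis. ((G x \<bullet> b) *\<^sub>R G x + u x *\<^sub>R H x b) \<bullet> b)"
          unfolding * by (simp add: algebra_simps)
      qed
      also have "\<dots> \<le> (LINT x|lborel. 4 * real n * real (n - 1) / R\<^sup>2 * bump R x ^ (n - 2) * ((u x)\<^sup>2 / 2))"
        by (rule integral_bump_laplacian(2)[OF has_hessian_half_square[OF u(1)] _ R n(1)]) simp
      also have "\<dots> = (LINT x|lborel. (2 * real n * real (n - 1)) / R\<^sup>2 * bump R x ^ (n - 2) * u x ^ 2 * 1)"
        by (rule Bochner_Integration.integral_cong) (auto simp: mult_ac)
      also have "\<dots> \<le> c * d * (LINT x|lborel. bump R x ^ n * (u x ^ 2 * u x powr q)) + d"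
        using elim(1) unfolding n2 by simp
      also have "c * d * (LINT x|lborel. bump R x ^ n * (u x ^ 2 * u x powr q)) 
          = (LINT x|lborel. c * d * (bump R x ^ n * (u x ^ 2 * u x powr q)))" by simp
      also have "\<dots> \<le> (LINT x|lborel. d * (u x * h x))"
      proof (rule integral_mono)
        show "integrable lborel (\<lambda>x. c * d * (bump R x ^ n * (u x ^ 2 * u x powr q)))"
          by (intro integrable_mult_right integrable_bump)
             (use R n0 du u q in \<open>auto intro!: continuous_intros continuous_on_powr'\<close>)
        show "integrable lborel (\<lambda>x. d * (u x * h x))" using int by simp
        fix x
        have "c * (bump R x ^ n * (u x ^ 2 * u x powr q)) \<le> bump R x ^ n * (u x * h x)"
          using mult_left_mono[OF le[of x], of "bump R x ^ n"] bump_nonneg[of R x] by (simp add: mult_ac)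
        then have "c * (bump R x ^ n * (u x ^ 2 * u x powr q)) \<le> u x * h x"
          using le_uh by (rule order_trans)
        then show "c * d * (bump R x ^ n * (u x ^ 2 * u x powr q)) \<le> d * (u x * h x)"
          using mult_left_mono[of _ _ d] d by (simp add: mult_ac)
      qed
      also have "\<dots> = d * I" by (simp add: I_def)
      finally have "(LINT x|lborel. bump R x ^ n * (G x \<bullet> G x)) \<le> (LINT x|lborel. bump R x ^ n * (u x * h x)) + d * I + d"
        by simp
      moreover have "(LINT x|lborel. bump R x ^ n * (u x * h x)) \<le> I"
        unfolding I_def by (rule integral_mono[OF iuh int le_uh])
      ultimately show ?case by (simp add: algebra_simps)
    qed
  qed
  note crit = bump_integral_criterion[OF cG _ n0(1) ev]
  show "integrable lborel (\<lambda>x. G x \<bullet> G x)"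
    by (rule crit(1)[of 1]) auto
  have "(LINT x|lborel. G x \<bullet> G x) \<le> I"
  proof (rule field_le_epsilon)
    fix e :: real assume "e > 0"
    \<comment> \<open>The choice \<open>d = e / (I + 1)\<close> turns the error
      \<open>d * (I + 1)\<close> into \<open>e\<close>; the summand 1 covers
      \<open>I = 0\<close>.\<close>
    then have "(LINT x|lborel. G x \<bullet> G x) \<le> I + e / (I + 1) * (I + 1)"
      by (intro crit(2)) (use I in auto)
    then show "(LINT x|lborel. G x \<bullet> G x) \<le> I + e" using I by simp
  qed
  then show "(LINT x|lborel. G x \<bullet> G x) \<le> (LINT x|lborel. u x * h x)" by (simp add: I_def)
qed

text \<open>The divergence of the Pohozaev field \<open>Y\<close> is the stated combination. Cutting
  off with bump^2 creates an error quadratic in x with weight 1/R^2. On the support it is dominated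
  by the integrable energy densities, and it tends to 0 pointwise; dominated convergence thus takes
  the place of boundary terms on well-chosen spheres.\<close>

lemma pohozaev:
  fixes u h Phi :: "'a::euclidean_space \<Rightarrow> real"
  assumes u: "has_hessian u G H"
    and eq: "\<And>x. - (\<Sum>b\<in>Basis. H x b \<bullet> b) = h x"
    and Phi: "\<And>x. (Phi has_derivative (\<lambda>e. h x * (G x \<bullet> e))) (at x)" "\<And>x. Phi x \<ge> 0"
    and int: "integrable lborel (\<lambda>x. G x \<bullet> G x)" "integrable lborel Phi"
  shows "(1 - DIM('a) / 2) * (LINT x|lborel. G x \<bullet> G x) + DIM('a) * (LINT x|lborel. Phi x) = 0"
proof -
  note du = has_hessianD[OF u]
  have lin: "linear (H x)" for x
    using du(2) by (rule has_derivative_linear)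
  have ch: "continuous_on UNIV h"
    unfolding eq[symmetric] by (intro continuous_intros continuous_on_trace[OF u])
  have cPhi: "continuous_on UNIV Phi"
    by (rule has_derivative_continuous_on[OF has_derivative_at_withinI[OF Phi(1)]])
  define Y where "Y x = (x \<bullet> G x) *\<^sub>R G x - ((G x \<bullet> G x) / 2) *\<^sub>R x + Phi x *\<^sub>R x" for x
  define Y' where "Y' x e = (e \<bullet> G x + x \<bullet> H x e) *\<^sub>R G x + (x \<bullet> G x) *\<^sub>R H x e
     - ((G x \<bullet> H x e) *\<^sub>R x + ((G x \<bullet> G x) / 2) *\<^sub>R e) + ((h x * (G x \<bullet> e)) *\<^sub>R x + Phi x *\<^sub>R e)" for x e
  have Y: "(Y has_derivative Y' x) (at x)" for x
  proof -
    have "((\<lambda>x. (G x \<bullet> G x) / 2) has_derivative (\<lambda>e. G x \<bullet> H x e)) (at x)"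
      by (rule has_derivative_eq_rhs[OF has_derivative_divide[OF has_derivative_inner[OF du(2) du(2)] has_derivative_const]])
         (auto simp: inner_commute)
    moreover have "((\<lambda>x. x \<bullet> G x) has_derivative (\<lambda>e. e \<bullet> G x + x \<bullet> H x e)) (at x)"
      by (rule has_derivative_eq_rhs[OF has_derivative_inner[OF has_derivative_ident du(2)]]) (simp add: add.commute)
    ultimately show ?thesis unfolding Y_def[abs_def]
      by (intro has_derivative_eq_rhs[OF has_derivative_add[OF has_derivative_diff[OF has_derivative_scaleR[OF _ du(2)] has_derivative_scaleR[OF _ has_derivative_ident]]
            has_derivative_scaleR[OF Phi(1) has_derivative_ident]]])
         (auto simp: Y'_def fun_eq_iff algebra_simps)
  qed
  define W where "W x = (1 - DIM('a) / 2) * (G x \<bullet> G x) + DIM('a) * Phi x" for x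
  have trY': "(\<Sum>b\<in>Basis. Y' x b \<bullet> b) = W x" for x
  proof -
    have Hsum: "(\<Sum>b\<in>Basis. (v \<bullet> H x b) * (w \<bullet> b)) = v \<bullet> H x w" for v w
    proof -
      have "v \<bullet> H x w = v \<bullet> H x (\<Sum>b\<in>Basis. (w \<bullet> b) *\<^sub>R b)" by (simp add: euclidean_representation)
      also have "\<dots> = (\<Sum>b\<in>Basis. (v \<bullet> H x b) * (w \<bullet> b))"
        by (simp add: linear_sum[OF lin] linear_cmul[OF lin] inner_sum_right mult.commute)
      finally show ?thesis by simp
    qed
    have tr: "(\<Sum>b\<in>Basis. H x b \<bullet> b) = - h x" by (simp flip: eq)
    have "(\<Sum>b\<in>Basis. Y' x b \<bullet> b) = (\<Sum>b\<in>Basis. (G x \<bullet> b) * (G x \<bullet> b) + (x \<bullet> H x b) * (G x \<bullet> b) + (x \<bullet> G x) * (H x b \<bullet> b)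
       - ((G x \<bullet> H x b) * (x \<bullet> b) + (G x \<bullet> G x) / 2) + (h x * ((G x \<bullet> b) * (x \<bullet> b)) + Phi x))"
    proof (intro sum.cong refl)
      fix b :: 'a assume "b \<in> Basis"
      then have "b \<bullet> b = 1" by (simp add: inner_Basis)
      then show "Y' x b \<bullet> b = (G x \<bullet> b) * (G x \<bullet> b) + (x \<bullet> H x b) * (G x \<bullet> b) + (x \<bullet> G x) * (H x b \<bullet> b)
       - ((G x \<bullet> H x b) * (x \<bullet> b) + (G x \<bullet> G x) / 2) + (h x * ((G x \<bullet> b) * (x \<bullet> b)) + Phi x)"
        by (simp add: Y'_def inner_add_left inner_diff_left inner_commute[of b "G x"] distrib_right mult.assoc)
    qed
    also have "\<dots> = G x \<bullet> G x + x \<bullet> H x (G x) + (x \<bullet> G x) * (- h x) - (G x \<bullet> H x x + DIM('a) * ((G x \<bullet> G x) / 2)) + (h x * (G x \<bullet> x) + DIM('a) * Phi x)"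
      unfolding sum.distrib sum_subtractf sum_distrib_left[symmetric] Hsum tr
        euclidean_inner[symmetric] sum_constant by simp
    \<comment> \<open>One term comes from differentiating x \<bullet> grad u, the other from |grad
      u|^2 / 2; symmetry of the Hessian makes them cancel.\<close>
    also have "x \<bullet> H x (G x) = G x \<bullet> H x x"
      using hessian_symmetric[OF u, of x "G x" x] by (simp add: inner_commute)
    finally show ?thesis by (simp add: W_def inner_commute algebra_simps)
  qed
  define s where "s i x = bump (real (Suc i)) x ^ 2 * W x
     - 4 / (real (Suc i))\<^sup>2 * bump (real (Suc i)) x * ((x \<bullet> G x)\<^sup>2 - (G x \<bullet> G x) * (x \<bullet> x) / 2 + Phi x * (x \<bullet> x))" for i x
  have s0: "(LINT x|lborel. s i x) = 0" for i
  proof -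
    define R where "R = real (Suc i)"
    have R: "R > 0" by (simp add: R_def)
    define P where "P x = (- (2 * real 2 / R\<^sup>2) * bump R x ^ (2 - 1)) *\<^sub>R x" for x :: 'a
    define D where "D x e = (P x \<bullet> e) *\<^sub>R Y x + (bump R x ^ 2) *\<^sub>R Y' x e" for x e
    have "(LINT x|lborel. (\<Sum>b\<in>Basis. D x b \<bullet> b)) = 0"
    proof (rule integral_divergence_eq_0)
      show "((\<lambda>x. (bump R x ^ 2) *\<^sub>R Y x) has_derivative D x) (at x)" for x
        unfolding D_def P_def
        by (rule has_derivative_eq_rhs[OF has_derivative_scaleR[OF bump_power_derivative Y]]) (auto simp: fun_eq_iff)
      show "continuous_on UNIV (\<lambda>x. D x b)" for b
        unfolding D_def P_def Y_def Y'_def by (intro continuous_intros du ch cPhi) auto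
      show "norm x > R \<Longrightarrow> (bump R x ^ 2) *\<^sub>R Y x = 0" for x
        using bump_eq_0[OF R, of x] by simp
    qed
    also have "(\<lambda>x. \<Sum>b\<in>Basis. D x b \<bullet> b) = s i"
    proof
      fix x
      have "(\<Sum>b\<in>Basis. D x b \<bullet> b) = (\<Sum>b\<in>Basis. (P x \<bullet> b) * (Y x \<bullet> b) + bump R x ^ 2 * (Y' x b \<bullet> b))"
        by (simp add: D_def inner_add_left)
      also have "\<dots> = P x \<bullet> Y x + bump R x ^ 2 * W x"
        by (simp add: sum.distrib sum_distrib_left[symmetric] euclidean_inner[symmetric] trY')
      also have "P x \<bullet> Y x = - (4 / R\<^sup>2 * bump R x * ((x \<bullet> G x)\<^sup>2 - (G x \<bullet> G x) * (x \<bullet> x) / 2 + Phi x * (x \<bullet> x)))"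
        by (simp add: P_def Y_def inner_add_right inner_diff_right power2_eq_square[of "x \<bullet> G x"] algebra_simps)
      finally show "(\<Sum>b\<in>Basis. D x b \<bullet> b) = s i x" by (simp add: s_def R_def)
    qed
    finally show ?thesis .
  qed
  have "(\<lambda>i. LINT x|lborel. s i x) \<longlonglongrightarrow> (LINT x|lborel. W x)"
  proof (rule integral_dominated_convergence)
    have cW: "continuous_on UNIV W" unfolding W_def by (intro continuous_intros du cPhi) 
    then show "W \<in> borel_measurable lborel" by (simp add: borel_measurable_continuous_onI)
    have "continuous_on UNIV (s i)" for i
      unfolding s_def by (intro continuous_intros du cPhi cW) auto
    then show "s i \<in> borel_measurable lborel" for i by (simp add: borel_measurable_continuous_onI)
    show "integrable lborel (\<lambda>x. \<bar>W x\<bar> + (6 * (G x \<bullet> G x) + 4 * Phi x))"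
      unfolding W_def using int by auto
    have f: "filterlim (\<lambda>i. real (Suc i)) at_top sequentially"
      by (rule filterlim_compose[OF filterlim_real_sequentially filterlim_Suc])
    show "AE x in lborel. (\<lambda>i. s i x) \<longlonglongrightarrow> W x"
    proof (rule AE_I2)
      fix x :: 'a
      have b: "(\<lambda>i. bump (real (Suc i)) x) \<longlonglongrightarrow> 1"
        by (rule filterlim_compose[OF bump_tendsto_1 f])
      have "(\<lambda>i. 4 / (real (Suc i))\<^sup>2) \<longlonglongrightarrow> 0"
        by (intro tendsto_divide_0[OF tendsto_const] filterlim_at_top_imp_at_infinity filterlim_pow_at_top f) simp
      then have "(\<lambda>i. s i x) \<longlonglongrightarrow> 1 ^ 2 * W x - 0 * 1 * ((x \<bullet> G x)\<^sup>2 - (G x \<bullet> G x) * (x \<bullet> x) / 2 + Phi x * (x \<bullet> x))"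
        unfolding s_def by (intro tendsto_intros b)
      then show "(\<lambda>i. s i x) \<longlonglongrightarrow> W x" by simp
    qed
    show "AE x in lborel. norm (s i x) \<le> \<bar>W x\<bar> + (6 * (G x \<bullet> G x) + 4 * Phi x)" for i
    proof (rule AE_I2)
      fix x :: 'a
      define R where "R = real (Suc i)"
      have R: "R > 0" by (simp add: R_def)
      define T where "T = (x \<bullet> G x)\<^sup>2 - (G x \<bullet> G x) * (x \<bullet> x) / 2 + Phi x * (x \<bullet> x)"
      \<comment> \<open>By Cauchy-Schwarz \<open>T\<close> is at most \<open>x \<bullet> x\<close>
        times 3/2 |grad u|^2 + Phi, and \<open>x \<bullet> x \<le> R\<^sup>2\<close> on the support;
        the factor 4 turns 3/2 into 6.\<close>
      have T: "\<bar>4 / R\<^sup>2 * bump R x * T\<bar> \<le> 6 * (G x \<bullet> G x) + 4 * Phi x"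
      proof (cases "bump R x = 0")
        case True
        then show ?thesis using Phi(2)[of x] by simp
      next
        case False
        have xx: "x \<bullet> x \<le> R\<^sup>2" by (rule bump_nonzeroD[OF R False])
        have "(x \<bullet> G x)\<^sup>2 \<le> (x \<bullet> x) * (G x \<bullet> G x)" by (rule Cauchy_Schwarz_ineq)
        then have "\<bar>T\<bar> \<le> (x \<bullet> x) * (3 / 2 * (G x \<bullet> G x) + Phi x)"
          using mult_nonneg_nonneg[OF inner_ge_zero[of x] inner_ge_zero[of "G x"]]
            mult_nonneg_nonneg[OF inner_ge_zero[of x] Phi(2)[of x]] zero_le_power2[of "x \<bullet> G x"]
          unfolding T_def distrib_left abs_le_iff mult.commute[of "G x \<bullet> G x"] mult.commute[of "Phi x"]
          by linarith
        also have "\<dots> \<le> R\<^sup>2 * (3 / 2 * (G x \<bullet> G x) + Phi x)"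
          using xx Phi(2)[of x] by (intro mult_right_mono) auto
        finally have 1: "\<bar>T\<bar> \<le> R\<^sup>2 * (3 / 2 * (G x \<bullet> G x) + Phi x)" .
        have "\<bar>4 / R\<^sup>2 * bump R x * T\<bar> = bump R x * (4 / R\<^sup>2 * \<bar>T\<bar>)"
          using bump_nonneg[of R x] by (simp add: abs_mult)
        also have "\<dots> \<le> 1 * (4 / R\<^sup>2 * \<bar>T\<bar>)"
          by (intro mult_right_mono bump_le_1) auto
        also have "\<dots> \<le> 4 / R\<^sup>2 * (R\<^sup>2 * (3 / 2 * (G x \<bullet> G x) + Phi x))"
          unfolding mult_1 by (intro mult_left_mono 1) auto
        also have "\<dots> = 6 * (G x \<bullet> G x) + 4 * Phi x" using R by simp
        finally show ?thesis .
      qed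
      have "\<bar>bump R x ^ 2 * W x\<bar> \<le> \<bar>W x\<bar>"
        using bump_nonneg[of R x] bump_le_1[of R x]
        by (simp add: abs_mult power_le_one mult_left_le_one_le)
      then have "\<bar>bump R x ^ 2 * W x - 4 / R\<^sup>2 * bump R x * T\<bar> \<le> \<bar>W x\<bar> + (6 * (G x \<bullet> G x) + 4 * Phi x)"
        using T by linarith
      then show "norm (s i x) \<le> \<bar>W x\<bar> + (6 * (G x \<bullet> G x) + 4 * Phi x)"
        by (simp add: s_def R_def T_def)
    qed
  qed
  then have "(LINT x|lborel. W x) = 0" by (simp add: s0 LIMSEQ_const_iff)
  then show ?thesis unfolding W_def using int by simp
qed

section \<open>The nonlinearity\<close>

lemma convex_half_line_tangent:
  fixes f :: "real \<Rightarrow> real"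
  assumes "convex_on {0..} f" "(f has_real_derivative d) (at s)" "s > 0" "t \<ge> 0"
  shows "d * (t - s) \<le> f t - f s"
  by (rule convex_on_imp_above_tangent[where A = "{0..}"])
     (use assms in \<open>auto intro: has_field_derivative_at_within simp: interior_Ici[of "0::real" "-1"]\<close>)

lemma convex_half_line_deriv_mono:
  fixes f :: "real \<Rightarrow> real"
  assumes "convex_on {0..} f" "(f has_real_derivative c) (at s)" "(f has_real_derivative d) (at t)"
    "0 < s" "s \<le> t"
  shows "c \<le> d"
proof (cases "s = t")
  case True
  then show ?thesis using DERIV_unique assms(2,3) by blast
next
  case False
  have "c * (t - s) \<le> f t - f s" "d * (s - t) \<le> f s - f t"
    using convex_half_line_tangent assms by (metis less_imp_le less_le_trans)+
  then have "0 \<le> (d - c) * (t - s)" by (simp add: algebra_simps)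
  then show ?thesis using False assms(5) by (simp add: zero_le_mult_iff)
qed

text \<open>The derivative of f / f' is 1 - 1 / q, so f (s) / (s f' (s)) tends to 1 / p0.\<close>

lemma log_derivative_tendsto_conj_exponent:
  fixes f f' f'' :: "real \<Rightarrow> real" and q0 :: ereal
  assumes cv: "convex_on {0..} f" and f0: "f 0 = 0" and pos: "\<And>s. s > 0 \<Longrightarrow> f s > 0"
    and d1: "\<And>s. s > 0 \<Longrightarrow> (f has_real_derivative f' s) (at s)"
    and d2: "\<And>s. s > 0 \<Longrightarrow> (f' has_real_derivative f'' s) (at s)"
    and q: "((\<lambda>s. if f s * f'' s \<noteq> 0 then ereal ((f' s)\<^sup>2 / (f s * f'' s)) else \<infinity>) \<longlongrightarrow> q0) (at_right 0)"
    and fin: "conj_exponent q0 \<noteq> \<infinity>"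
  obtains p where "1 \<le> p" "conj_exponent q0 = ereal p" "((\<lambda>s. s * f' s / f s) \<longlongrightarrow> p) (at_right 0)"
proof -
  have ev0: "\<forall>\<^sub>F s in at_right (0::real). s > 0" by (simp add: eventually_at_right_less)
  have sf: "f s \<le> s * f' s" if "s > 0" for s
    using convex_half_line_tangent[OF cv d1[OF that] that, of 0] f0 by (simp add: mult.commute)
  have f'pos: "f' s > 0" if "s > 0" for s
  proof -
    have "0 < s * f' s" using sf[OF that] pos[OF that] by linarith
    then show ?thesis using that by (simp add: zero_less_mult_iff)
  qed
  have f''nn: "f'' s \<ge> 0" if "s > 0" for s
  proof (rule ccontr)
    assume "\<not> f'' s \<ge> 0"
    then have "f'' s < 0" by simp
    from DERIV_neg_dec_right[OF d2[OF that] this]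
    obtain e where e: "e > 0" "\<And>h. 0 < h \<Longrightarrow> h < e \<Longrightarrow> f' s > f' (s + h)"
      by blast
    have "f' s \<le> f' (s + e / 2)"
      by (rule convex_half_line_deriv_mono[OF cv d1 d1]) (use that e in auto)
    then show False using e(2)[of "e / 2"] e(1) by simp
  qed
  define g where "g s = f s / f' s" for s
  \<comment> \<open>This is 1/q, with the value 0 where q is infinite; it keeps the argument within
    the reals.\<close>
  define rho where "rho s = f s * f'' s / (f' s)\<^sup>2" for s
  have g: "0 < g s" "g s \<le> s" if "s > 0" for s
    using that pos[OF that] f'pos[OF that] sf[OF that] by (auto simp: g_def field_simps)
  have dg: "(g has_real_derivative 1 - rho s) (at s)" if "s > 0" for s
    unfolding g_def[abs_def] rho_def using f'pos[OF that]
    by (auto intro!: derivative_eq_intros d1 d2 that simp: field_simps power2_eq_square)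
  have rho: "rho s \<ge> 0" if "s > 0" for s
    using pos[OF that] f''nn[OF that] by (simp add: rho_def)
  have qrho: "(if f s * f'' s \<noteq> 0 then ereal ((f' s)\<^sup>2 / (f s * f'' s)) else \<infinity>)
      = (if rho s = 0 then \<infinity> else ereal (1 / rho s))" if "s > 0" for s
    using pos[OF that] f'pos[OF that] by (auto simp: rho_def)
  have q': "((\<lambda>s. if rho s = 0 then \<infinity> else ereal (1 / rho s)) \<longlongrightarrow> q0) (at_right 0)"
    by (rule Lim_transform_eventually[OF q eventually_mono[OF ev0 qrho]])
  have g0: "(g \<longlongrightarrow> 0) (at_right 0)"
    by (rule tendsto_sandwich[of "\<lambda>_. 0" _ _ "\<lambda>s. s"])
       (use ev0 g in \<open>auto elim!: eventually_mono intro: less_imp_le\<close>)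
  have q0_nn: "q0 \<ge> 0"
    by (rule tendsto_lowerbound[OF q']) (use ev0 rho in \<open>auto elim!: eventually_mono\<close>)
  have "\<exists>r. (rho \<longlongrightarrow> r) (at_right 0) \<and> r \<noteq> 1 \<and> conj_exponent q0 = ereal (1 / (1 - r))"
  proof (cases "q0 = \<infinity>")
    case True
    have "(rho \<longlongrightarrow> 0) (at_right 0)"
    proof (rule order_tendstoI)
      fix a :: real assume "a < 0"
      then show "\<forall>\<^sub>F s in at_right 0. a < rho s"
        using ev0 rho by (auto elim!: eventually_mono intro: less_le_trans)
    next
      fix a :: real assume a: "0 < a"
      have "\<forall>\<^sub>F s in at_right 0. ereal (1 / a) < (if rho s = 0 then \<infinity> else ereal (1 / rho s))"
        using q' True by (intro order_tendstoD) auto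
      then show "\<forall>\<^sub>F s in at_right 0. rho s < a"
        using ev0
      proof eventually_elim
        case (elim s)
        then show ?case using rho[of s] a by (cases "rho s = 0") (auto simp: field_simps)
      qed
    qed
    then show ?thesis using True by (intro exI[of _ 0]) (auto simp: conj_exponent_def one_ereal_def)
  next
    case False
    with q0_nn obtain a where a: "q0 = ereal a" "a \<ge> 0" by (cases q0) auto
    have evn: "\<forall>\<^sub>F s in at_right 0. rho s \<noteq> 0"
      using order_tendstoD(2)[OF q', of \<infinity>] a by (auto elim!: eventually_mono split: if_splits)
    have "((\<lambda>s. ereal (1 / rho s)) \<longlongrightarrow> ereal a) (at_right 0)"
      unfolding a(1)[symmetric]
      by (rule Lim_transform_eventually[OF q']) (use evn in \<open>auto elim!: eventually_mono\<close>)
    then have lim: "((\<lambda>s. 1 / rho s) \<longlongrightarrow> a) (at_right 0)" by simp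
    \<comment> \<open>If q tended to 0, then \<open>rho\<close> would exceed 1 near 0 and g = f/f'
      would decrease there. But g is positive with \<open>g t \<le> t\<close>, so it cannot stay
      above \<open>g s\<close> as t tends to 0.\<close>
    have "a \<noteq> 0"
    proof
      assume "a = 0"
      then have "\<forall>\<^sub>F s in at_right 0. 1 / rho s < 1" using lim by (intro order_tendstoD) auto
      then have "\<forall>\<^sub>F s in at_right 0. 1 - rho s < 0"
        using ev0 evn
      proof eventually_elim
        case (elim s)
        then show ?case using rho[of s] by (simp add: field_simps split: if_splits)
      qed
      then obtain b where b: "b > 0" "\<And>s. 0 < s \<Longrightarrow> s < b \<Longrightarrow> 1 - rho s < 0"
        unfolding eventually_at_right_field by auto
      define s where "s = b / 2"
      have s: "0 < s" "s < b" using b by (auto simp: s_def)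
      define t where "t = min (s / 2) (g s / 2)"
      have t: "0 < t" "t < s" "t < g s" using s g(1)[of s] by (auto simp: t_def min_def)
      have "g t > g s"
        by (rule DERIV_neg_imp_decreasing[OF t(2)]) (use dg b s t in \<open>force intro!: exI\<close>)
      then show False using g(2)[of t] t by simp
    qed
    moreover have "a \<noteq> 1" using fin a by (auto simp: conj_exponent_def one_ereal_def)
    moreover have "((\<lambda>s. inverse (1 / rho s)) \<longlongrightarrow> inverse a) (at_right 0)"
      using lim \<open>a \<noteq> 0\<close> by (rule tendsto_inverse)
    then have "(rho \<longlongrightarrow> 1 / a) (at_right 0)" by (simp add: divide_inverse)
    moreover have "conj_exponent q0 = ereal (1 / (1 - 1 / a))"
      using \<open>a \<noteq> 0\<close> \<open>a \<noteq> 1\<close> by (simp add: conj_exponent_def a one_ereal_def field_simps)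
    ultimately show ?thesis by (intro exI[of _ "1 / a"]) auto
  qed
  then obtain r where r: "(rho \<longlongrightarrow> r) (at_right 0)" "r \<noteq> 1" "conj_exponent q0 = ereal (1 / (1 - r))"
    by blast
  \<comment> \<open>L'Hospital transfers the limit of g' to g(s)/s, and 0 < g(s) \<le> s confines
    that limit to [0, 1]. It is not 0 because r = 1 is the case of an infinite conjugate
    exponent.\<close>
  have gs: "((\<lambda>s. g s / s) \<longlongrightarrow> 1 - r) (at_right 0)"
  proof (rule lhopital_right_0[where f' = "\<lambda>s. 1 - rho s" and g' = "\<lambda>_. 1"])
    show "\<forall>\<^sub>F s in at_right 0. (g has_real_derivative 1 - rho s) (at s)"
      using ev0 dg by (auto elim!: eventually_mono)
    show "((\<lambda>s. (1 - rho s) / 1) \<longlongrightarrow> 1 - r) (at_right 0)"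
      using r(1) by (auto intro!: tendsto_intros)
  qed (use ev0 g0 in \<open>auto elim!: eventually_mono intro!: tendsto_intros\<close>)
  have "1 - r \<ge> 0"
    by (rule tendsto_lowerbound[OF gs]) (use ev0 g in \<open>auto elim!: eventually_mono intro: less_imp_le\<close>)
  moreover have "1 - r \<le> 1"
    by (rule tendsto_upperbound[OF gs]) (use ev0 g in \<open>auto elim!: eventually_mono\<close>)
  ultimately have r': "0 < 1 - r" "1 - r \<le> 1" using r(2) by auto
  have "((\<lambda>s. inverse (g s / s)) \<longlongrightarrow> inverse (1 - r)) (at_right 0)"
    using gs r' by (intro tendsto_inverse) auto
  then have "((\<lambda>s. s * f' s / f s) \<longlongrightarrow> 1 / (1 - r)) (at_right 0)"
    by (simp add: g_def divide_inverse mult_ac)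
  then show ?thesis using that[of "1 / (1 - r)"] r' r(3) by simp
qed

text \<open>While s f'(s)/f(s) < P, the quotient f(s) s^(-P) is nonincreasing, so towards 0 it stays
  above its value at a fixed \<open>t\<close>. Beyond \<open>t\<close>, monotonicity of f suffices
  up to \<open>M\<close>.\<close>

lemma power_lower_bound:
  fixes f f' :: "real \<Rightarrow> real"
  assumes mono: "mono_on {0..} f" and f0: "f 0 = 0" and pos: "\<And>s. s > 0 \<Longrightarrow> f s > 0"
    and d1: "\<And>s. s > 0 \<Longrightarrow> (f has_real_derivative f' s) (at s)"
    and lim: "((\<lambda>s. s * f' s / f s) \<longlongrightarrow> p) (at_right 0)" and P: "p < P" "P > 0" and M: "M > 0"
  obtains c where "c > 0" "\<And>s. 0 \<le> s \<Longrightarrow> s \<le> M \<Longrightarrow> c * s powr P \<le> f s"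
proof -
  have "\<forall>\<^sub>F s in at_right 0. s * f' s / f s < P" using lim P by (intro order_tendstoD)
  then obtain b where b: "b > 0" "\<And>s. 0 < s \<Longrightarrow> s < b \<Longrightarrow> s * f' s / f s < P"
    unfolding eventually_at_right_field by auto
  define t where "t = b / 2"
  have t: "0 < t" "t < b" using b by (auto simp: t_def)
  define c where "c = min (f t * t powr (- P)) (f t * M powr (- P))"
  have c: "c > 0" using pos[OF t(1)] t M by (simp add: c_def)
  have "c * s powr P \<le> f s" if s: "0 \<le> s" "s \<le> M" for s
  proof -
    consider "s = 0" | "0 < s" "s \<le> t" | "t < s" using s by linarith
    then show ?thesis
    proof cases
      case 1
      then show ?thesis using f0 by simp
    next
      case 2
      have "f s * s powr (- P) \<ge> f t * t powr (- P)"
      proof (rule DERIV_nonpos_imp_nonincreasing[OF 2(2)])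
        fix x assume x: "s \<le> x" "x \<le> t"
        then have x0: "0 < x" using 2 by simp
        have "((\<lambda>x. f x * x powr (- P)) has_real_derivative f' x * x powr (- P) + f x * (- P * x powr (- P - 1))) (at x)"
          using x0 by (auto intro!: derivative_eq_intros d1)
        moreover have "f' x * x powr (- P) + f x * (- P * x powr (- P - 1)) = x powr (- P - 1) * (x * f' x - P * f x)"
          using x0 by (simp add: powr_diff powr_minus field_simps)
        moreover have "x * f' x - P * f x \<le> 0"
          using b(2)[of x] x x0 t pos[OF x0] by (simp add: field_simps)
        ultimately show "\<exists>y. ((\<lambda>x. f x * x powr (- P)) has_real_derivative y) (at x) \<and> y \<le> 0"
          by (metis mult_nonneg_nonpos powr_ge_zero)
      qed
      then have "c \<le> f s * s powr (- P)" by (simp add: c_def)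
      then show ?thesis using 2 by (simp add: powr_minus field_simps)
    next
      case 3
      have "c * s powr P \<le> f t * M powr (- P) * M powr P"
        using c s P t pos[OF t(1)] by (intro mult_mono powr_mono2) (auto simp: c_def intro: less_imp_le)
      also have "\<dots> = f t" using M by (simp add: powr_minus)
      also have "\<dots> \<le> f s" using mono 3 t by (auto simp: mono_on_def)
      finally show ?thesis .
    qed
  qed
  with c show ?thesis using that by blast
qed

text \<open>By convexity s f'(s) - f(s) is nondecreasing. Hence the positive value \<open>k\<close>
  that the limit guarantees at a small \<open>t\<close> persists up to \<open>M\<close>, and
  dividing by the largest value of f turns it into a relative gap.\<close>

lemma superlinear_gap:
  fixes f f' :: "real \<Rightarrow> real"
  assumes cv: "convex_on {0..} f" and mono: "mono_on {0..} f" and pos: "\<And>s. s > 0 \<Longrightarrow> f s > 0"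
    and d1: "\<And>s. s > 0 \<Longrightarrow> (f has_real_derivative f' s) (at s)"
    and lim: "((\<lambda>s. s * f' s / f s) \<longlongrightarrow> p) (at_right 0)" and p: "p > 1"
  obtains d where "d > 0" "\<And>s. 0 < s \<Longrightarrow> s \<le> M \<Longrightarrow> (1 + d) * f s \<le> s * f' s"
proof -
  define e where "e = (p - 1) / 2"
  have e: "e > 0" "1 + e < p" using p by (auto simp: e_def field_simps)
  have "\<forall>\<^sub>F s in at_right 0. 1 + e < s * f' s / f s" using lim e by (intro order_tendstoD)
  then obtain b where b: "b > 0" "\<And>s. 0 < s \<Longrightarrow> s < b \<Longrightarrow> 1 + e < s * f' s / f s"
    unfolding eventually_at_right_field by auto
  have small: "(1 + e) * f s \<le> s * f' s" if "0 < s" "s < b" for s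
    using b(2)[OF that] pos[OF that(1)] by (simp add: field_simps)
  define t where "t = b / 2"
  have t: "0 < t" "t < b" using b by (auto simp: t_def)
  define k where "k = t * f' t - f t"
  have k: "k > 0"
  proof -
    have "0 < e * f t" using e pos[OF t(1)] by simp
    then show ?thesis using small[OF t] by (simp add: k_def algebra_simps)
  qed
  define M' where "M' = max M t"
  have M': "M' > 0" "M \<le> M'" using t by (auto simp: M'_def)
  define d where "d = min e (k / f M')"
  have d: "d > 0" "d \<le> e" "d \<le> k / f M'" using e k pos[OF M'(1)] by (auto simp: d_def)
  have "(1 + d) * f s \<le> s * f' s" if s: "0 < s" "s \<le> M" for s
  proof (cases "s < t")
    case True
    have "(1 + d) * f s \<le> (1 + e) * f s" using d pos[OF s(1)] by (intro mult_right_mono) auto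
    then show ?thesis using small[of s] True s t by simp
  next
    case False
    have "f' t \<le> f' s"
      by (rule convex_half_line_deriv_mono[OF cv d1 d1]) (use False t s in auto)
    then have "t * (f' s - f' t) \<ge> 0" using t by simp
    moreover have "f' s * (t - s) \<le> f t - f s"
      using convex_half_line_tangent[OF cv d1[OF s(1)] s(1), of t] t by simp
    ultimately have "k \<le> s * f' s - f s" by (simp add: k_def algebra_simps)
    moreover have "d * f s \<le> k"
    proof -
      have "d * f s \<le> (k / f M') * f M'"
        using d s M' pos[OF s(1)] k pos[OF M'(1)] mono by (intro mult_mono) (auto simp: mono_on_def)
      then show ?thesis using pos[OF M'(1)] by simp
    qed
    ultimately show ?thesis by (simp add: algebra_simps)
  qed
  with d(1) show ?thesis using that by blast
qed

text \<open>Only s = 0 is delicate: f' increases, so it is bounded by f'(1) near 0, and the factor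
  s^2 forces the limit 0. This makes f'(u) u^2 continuous across the zeros of u.\<close>

lemma continuous_on_deriv_half_line_square:
  assumes cv: "convex_on {0..} f" and nn: "\<And>s. s > 0 \<Longrightarrow> deriv f s \<ge> 0"
    and d1: "\<And>s. s > 0 \<Longrightarrow> (f has_real_derivative deriv f s) (at s)"
    and c: "continuous_on {0<..} (deriv f)"
  shows "continuous_on {0..} (\<lambda>s. deriv_half_line f s * s\<^sup>2)"
  unfolding continuous_on_eq_continuous_within
proof
  fix s :: real assume s: "s \<in> {0..}"
  show "continuous (at s within {0..}) (\<lambda>s. deriv_half_line f s * s\<^sup>2)"
  proof (cases "s = 0")
    case False
    have "continuous_on {0<..} (\<lambda>s. deriv_half_line f s * s\<^sup>2)"
      by (rule continuous_on_eq[where f = "\<lambda>s. deriv f s * s\<^sup>2"])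
         (auto intro!: continuous_intros c simp: deriv_half_line_def)
    then show ?thesis using False s
      by (auto simp: continuous_on_eq_continuous_at open_greaterThan intro: continuous_at_imp_continuous_at_within)
  next
    case True
    have "((\<lambda>s. deriv_half_line f s * s\<^sup>2) \<longlongrightarrow> 0) (at 0 within {0..})"
    proof (rule Lim_null_comparison)
      show "\<forall>\<^sub>F s in at 0 within {0..}. norm (deriv_half_line f s * s\<^sup>2) \<le> deriv f 1 * s\<^sup>2"
        unfolding eventually_at
      proof (intro exI[of _ 1] conjI ballI impI)
        fix s :: real assume s: "s \<in> {0..}" "s \<noteq> 0 \<and> dist s 0 < 1"
        then have "deriv f s \<le> deriv f 1"
          by (intro convex_half_line_deriv_mono[OF cv d1 d1]) auto
        then show "norm (deriv_half_line f s * s\<^sup>2) \<le> deriv f 1 * s\<^sup>2"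
          using s nn[of s] by (auto simp: deriv_half_line_def abs_mult intro!: mult_right_mono)
      qed simp
      show "((\<lambda>s. deriv f 1 * s\<^sup>2) \<longlongrightarrow> 0) (at 0 within {0..})"
        by (auto intro!: tendsto_eq_intros)
    qed
    then show ?thesis using True by (simp add: continuous_within)
  qed
qed

section \<open>The Liouville theorem\<close>

text \<open>The admissible function is u p. The compact set is enclosed in a ball because the
  cutoffs in use are radial.\<close>

lemma stable_outside_compact_test:
  fixes u :: "'a::euclidean_space \<Rightarrow> real"
  assumes stab: "stable_outside_compact f u" and u: "has_hessian u G H"
  obtains r where "r \<ge> 0"
    "\<And>p P R. (\<And>x. (p has_derivative (\<lambda>e. P x \<bullet> e)) (at x)) \<Longrightarrow> continuous_on UNIV P \<Longrightarrow>
        (\<And>x. norm x > R \<Longrightarrow> p x = 0) \<Longrightarrow> (\<And>x. norm x < r \<Longrightarrow> p x = 0) \<Longrightarrow>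
        (LINT x|lborel. deriv_half_line f (u x) * (u x)\<^sup>2 * (p x)\<^sup>2)
          \<le> (LINT x|lborel. (norm (u x *\<^sub>R P x + p x *\<^sub>R G x))\<^sup>2)"
proof -
  note du = has_hessianD[OF u]
  obtain K where K: "compact K" and st: "\<And>\<phi>. C1_fun \<phi> \<Longrightarrow> compact (closure (support_on UNIV \<phi>)) \<Longrightarrow>
      closure (support_on UNIV \<phi>) \<subseteq> - K \<Longrightarrow>
      (LINT x|lborel. deriv_half_line f (u x) * (\<phi> x)\<^sup>2) \<le> (LINT x|lborel. (norm (gradient \<phi> x))\<^sup>2)"
    using stab unfolding stable_outside_compact_def by blast
  obtain b where b: "\<forall>x\<in>K. norm x \<le> b" using compact_imp_bounded[OF K] unfolding bounded_iff by blast
  \<comment> \<open>The absolute value covers an empty \<open>K\<close> with negative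
    \<open>b\<close>; the summand 1 keeps \<open>K\<close> off the closed set where
    \<open>r \<le> norm x\<close>, which contains the closure of the support.\<close>
  define r where "r = \<bar>b\<bar> + 1"
  show ?thesis
  proof (rule that[of r])
    show "r \<ge> 0" by (simp add: r_def)
    fix p :: "'a \<Rightarrow> real" and P R
    assume p: "\<And>x. (p has_derivative (\<lambda>e. P x \<bullet> e)) (at x)" and cP: "continuous_on UNIV P"
      and po: "\<And>x. norm x > R \<Longrightarrow> p x = 0" and pi: "\<And>x. norm x < r \<Longrightarrow> p x = 0"
    have cp: "continuous_on UNIV p"
      by (rule has_derivative_continuous_on[OF has_derivative_at_withinI[OF p]])
    define w where "w x = u x * p x" for x
    have dw: "(w has_derivative (\<lambda>e. (u x *\<^sub>R P x + p x *\<^sub>R G x) \<bullet> e)) (at x)" for x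
      unfolding w_def
      by (rule has_derivative_eq_rhs[OF has_derivative_mult[OF du(1) p]])
         (simp add: fun_eq_iff inner_add_left)
    have "C1_fun w"
      by (rule C1_funI[OF dw]) (intro continuous_intros du cp cP)
    moreover have "closure (support_on UNIV w) \<subseteq> cball 0 R"
      by (rule closure_minimal) (use po in \<open>force simp: support_on_def w_def not_le[symmetric]\<close>)+
    then have "compact (closure (support_on UNIV w))"
      by (metis bounded_cball bounded_subset closed_closure compact_eq_bounded_closed)
    moreover have "closure (support_on UNIV w) \<subseteq> {x. r \<le> norm x}"
      by (rule closure_minimal)
         (use pi in \<open>force simp: support_on_def w_def not_less[symmetric]\<close>, intro closed_Collect_le continuous_intros)
    then have "closure (support_on UNIV w) \<subseteq> - K"
      using b by (force simp: r_def)
    ultimately have "(LINT x|lborel. deriv_half_line f (u x) * (w x)\<^sup>2) \<le> (LINT x|lborel. (norm (gradient w x))\<^sup>2)"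
      by (rule st)
    then show "(LINT x|lborel. deriv_half_line f (u x) * (u x)\<^sup>2 * (p x)\<^sup>2)
          \<le> (LINT x|lborel. (norm (u x *\<^sub>R P x + p x *\<^sub>R G x))\<^sup>2)"
      by (simp add: gradient_eqI[OF dw]) (simp add: w_def power_mult_distrib mult.assoc)
  qed
qed

section \<open>The antiderivative F along the solution\<close>

lemma antiderivative_le:
  fixes f :: "real \<Rightarrow> real"
  assumes c: "continuous_on {0..} f" and mono: "mono_on {0..} f" and f0: "0 \<le> f 0" and s: "0 \<le> s"
  shows "0 \<le> integral {0..s} f" "integral {0..s} f \<le> s * f s"
proof -
  have i: "f integrable_on {0..s}"
    by (intro integrable_continuous_real continuous_on_subset[OF c]) auto
  have nn: "0 \<le> f t" if "0 \<le> t" for t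
    using mono that f0 by (auto simp: mono_on_def intro: order_trans)
  show "0 \<le> integral {0..s} f"
    by (rule Henstock_Kurzweil_Integration.integral_nonneg[OF i]) (use nn in auto)
  have "integral {0..s} f \<le> integral {0..s} (\<lambda>_. f s)"
    by (rule integral_le[OF i]) (use mono s in \<open>auto simp: mono_on_def\<close>)
  then show "integral {0..s} f \<le> s * f s" using s by simp
qed

text \<open>f is controlled only on the half-line, so at a zero of u the antiderivative may have
  just a right derivative. The chain rule within \<open>range u\<close> needs no more, and the
  composition is differentiable in the full sense.\<close>

lemma antiderivative_compose:
  fixes f :: "real \<Rightarrow> real" and u :: "'a::euclidean_space \<Rightarrow> real"
  assumes c: "continuous_on {0..} f" and u: "\<And>x. (u has_derivative (\<lambda>e. G x \<bullet> e)) (at x)"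
    "\<And>x. 0 \<le> u x" "\<And>x. u x \<le> M"
  shows "((\<lambda>x. integral {0..u x} f) has_derivative (\<lambda>e. f (u x) * (G x \<bullet> e))) (at x)"
proof -
  have "((\<lambda>s. integral {0..s} f) has_real_derivative f (u x)) (at (u x) within {0..M})"
    by (rule integral_has_real_derivative) (use u in \<open>auto intro: continuous_on_subset[OF c]\<close>)
  then have "((\<lambda>s. integral {0..s} f) has_derivative (*) (f (u x))) (at (u x) within range u)"
    unfolding has_field_derivative_def by (rule has_derivative_subset) (use u in auto)
  from has_derivative_in_compose[OF u(1) this] show ?thesis .
qed

lemma stable_subcritical_liouville:
  fixes f :: "real \<Rightarrow> real" and u :: "'a::euclidean_space \<Rightarrow> real"
  assumes c: "continuous_on {0..} f" and C2: "C2_real_on {0<..} f" and mono: "mono_on {0..} f"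
    and cv: "convex_on {0..} f" and pos: "\<And>s. s > 0 \<Longrightarrow> f s > 0" and f0: "f 0 = 0"
    and u: "has_hessian u G H" "\<And>x. u x \<ge> 0" "\<And>x. u x \<le> M"
    and eq: "\<And>x. - (\<Sum>b\<in>Basis. H x b \<bullet> b) = f (u x)"
    and stab: "stable_outside_compact f u"
    and lim: "((\<lambda>s. s * deriv f s / f s) \<longlongrightarrow> p) (at_right 0)" and p: "p > 1"
    and N: "DIM('a) \<ge> 3" "p < (real DIM('a) + 2) / (real DIM('a) - 2)"
    and F: "\<And>s. s \<ge> 0 \<Longrightarrow> s * f s \<le> (p + 1) * integral {0..s} f"
  shows "u x = 0"
proof -
  note du = has_hessianD[OF u(1)]
  have d1: "(f has_real_derivative deriv f s) (at s)" and d2: "deriv f differentiable (at s)" if "s > 0" for s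
    using C2 that unfolding C2_real_on_def by (auto simp: DERIV_deriv_iff_real_differentiable)
  have cd: "continuous_on {0<..} (deriv f)"
    using d2 by (auto intro!: continuous_at_imp_continuous_on differentiable_imp_continuous_within)
  have nn: "deriv f s \<ge> 0" if "s > 0" for s
  proof -
    have "0 \<le> s * deriv f s"
      using convex_half_line_tangent[OF cv d1[OF that] that, of 0] pos[OF that] f0 by (simp add: mult.commute)
    then show ?thesis using that by (simp add: zero_le_mult_iff)
  qed
  define M' where "M' = max M 1"
  have M': "M' > 0" "\<And>x. u x \<le> M'" using u(3) by (auto simp: M'_def le_max_iff_disj)
  define N' where "N' = real DIM('a)"
  have N': "N' \<ge> 3" "p < (N' + 2) / (N' - 2)" using N by (auto simp: N'_def)
  have gap: "p - 1 < 4 / (N' - 2)" using N' by (simp add: field_simps)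
  \<comment> \<open>The midpoint of p - 1 and 4/(N - 2): the exponent q + 1 exceeds p, as the lower
    bound for f requires, and is still subcritical, as the energy estimates require.\<close>
  define q where "q = (p - 1 + 4 / (N' - 2)) / 2"
  have q: "p < q + 1" "q < 4 / (N' - 2)" "q > 0"
    using gap p by (simp_all only: q_def) argo+
  have Nq: "real DIM('a) < 2 + 4 / q" using q N' by (simp add: field_simps flip: N'_def)
  obtain k where k: "k > 0" "\<And>s. 0 \<le> s \<Longrightarrow> s \<le> M' \<Longrightarrow> k * s powr (q + 1) \<le> f s"
    using power_lower_bound[OF mono f0 pos d1 lim q(1) _ M'(1)] q by auto
  obtain d where d: "d > 0" "\<And>s. 0 < s \<Longrightarrow> s \<le> M' \<Longrightarrow> (1 + d) * f s \<le> s * deriv f s"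
    using superlinear_gap[OF cv mono pos d1 lim p, of M'] by blast
  define h where "h x = f (u x)" for x
  have le: "k * ((u x)\<^sup>2 * u x powr q) \<le> u x * h x" for x
  proof -
    have "u x * (k * u x powr (q + 1)) \<le> u x * h x"
      unfolding h_def using u(2) M'(2) by (intro mult_left_mono k(2))
    moreover have "u x powr (q + 1) = u x * u x powr q"
      using powr_mult_base[OF u(2)[of x], of q] by (simp add: add.commute)
    ultimately show ?thesis by (simp add: power2_eq_square mult_ac)
  qed
  have h: "- (\<Sum>b\<in>Basis. H x b \<bullet> b) = h x" for x using eq by (simp add: h_def)
  obtain r where r: "r \<ge> 0" and test: 
    "\<And>p P R. (\<And>x. (p has_derivative (\<lambda>e. P x \<bullet> e)) (at x)) \<Longrightarrow> continuous_on UNIV P \<Longrightarrow>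
        (\<And>x. norm x > R \<Longrightarrow> p x = 0) \<Longrightarrow> (\<And>x. norm x < r \<Longrightarrow> p x = 0) \<Longrightarrow>
        (LINT x|lborel. deriv_half_line f (u x) * (u x)\<^sup>2 * (p x)\<^sup>2)
          \<le> (LINT x|lborel. (norm (u x *\<^sub>R P x + p x *\<^sub>R G x))\<^sup>2)"
    using stable_outside_compact_test[OF stab u(1)] by blast
  have cD: "continuous_on UNIV (\<lambda>x. deriv_half_line f (u x) * (u x)\<^sup>2)"
    by (rule continuous_on_compose2[OF continuous_on_deriv_half_line_square[OF cv nn d1 cd] du(4)])
       (use u in auto)
  have dD: "(1 + d) * (u x * h x) \<le> deriv_half_line f (u x) * (u x)\<^sup>2" for x
  proof (cases "u x = 0")
    case False
    then have ux: "u x > 0" using u(2)[of x] by simp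
    have "u x * ((1 + d) * f (u x)) \<le> u x * (u x * deriv f (u x))"
      using ux M'(2) by (intro mult_left_mono d(2)) auto
    then show ?thesis using ux by (simp add: h_def deriv_half_line_def power2_eq_square mult_ac)
  qed simp
  have iuh: "integrable lborel (\<lambda>x. u x * h x)"
    by (rule stable_finite_energy[OF u(1,2) h k(1) q(3) le Nq d(1) cD dD r test])
  have iG: "integrable lborel (\<lambda>x. G x \<bullet> G x)" and leG: "(LINT x|lborel. G x \<bullet> G x) \<le> (LINT x|lborel. u x * h x)"
    by (rule finite_energy_gradient[OF u(1,2) h k(1) q(3) le Nq iuh])+
  define Phi where "Phi x = integral {0..u x} f" for x
  have dPhi: "(Phi has_derivative (\<lambda>e. h x * (G x \<bullet> e))) (at x)" for x
    unfolding Phi_def h_def by (rule antiderivative_compose[OF c du(1) u(2,3)])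
  have Phi: "0 \<le> Phi x" "Phi x \<le> u x * h x" "u x * h x \<le> (p + 1) * Phi x" for x
    unfolding Phi_def h_def using antiderivative_le[OF c mono _ u(2)] f0 F[OF u(2)] by auto
  have cPhi: "continuous_on UNIV Phi"
    by (rule has_derivative_continuous_on[OF has_derivative_at_withinI[OF dPhi]])
  have iPhi: "integrable lborel Phi"
    by (rule Bochner_Integration.integrable_bound[OF iuh])
       (use Phi cPhi in \<open>auto intro!: AE_I2 borel_measurable_continuous_onI intro: order_trans[OF _ abs_ge_self]\<close>)
  define I where "I = (LINT x|lborel. u x * h x)"
  define J where "J = (LINT x|lborel. Phi x)"
  define E where "E = (LINT x|lborel. G x \<bullet> G x)"
  have "(1 - N' / 2) * E + N' * J = 0"
    unfolding E_def J_def N'_def by (rule pohozaev[OF u(1) h dPhi Phi(1) iG iPhi])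
  moreover have "E \<le> I" using leG by (simp add: E_def I_def)
  moreover have IJ: "I \<le> (p + 1) * J"
  proof -
    have "I \<le> (LINT x|lborel. (p + 1) * Phi x)"
      unfolding I_def by (rule integral_mono[OF iuh]) (use iPhi Phi in auto)
    then show ?thesis by (simp add: J_def)
  qed
  moreover have J0: "J \<ge> 0" unfolding J_def using Phi by (simp add: integral_nonneg_AE)
  ultimately have "N' * J \<le> (N' / 2 - 1) * ((p + 1) * J)"
  proof -
    assume a: "(1 - N' / 2) * E + N' * J = 0" "E \<le> I" "I \<le> (p + 1) * J"
    have "N' * J = (N' / 2 - 1) * E" using a(1) by (simp add: algebra_simps)
    also have "\<dots> \<le> (N' / 2 - 1) * ((p + 1) * J)" using a N' by (intro mult_left_mono) auto
    finally show ?thesis .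
  qed
  then have "(2 * N' - (N' - 2) * (p + 1)) * J \<le> 0" by (simp add: algebra_simps)
  \<comment> \<open>Subcriticality of p with denominators cleared. Since Pohozaev gives
    \<open>N' * J = (N' / 2 - 1) * E\<close> with \<open>E \<le> I \<le> (p + 1) * J\<close>,
    positivity of this factor leaves no room for \<open>J > 0\<close>.\<close>
  moreover have "2 * N' - (N' - 2) * (p + 1) > 0" using N' by (simp add: field_simps)
  ultimately have "J \<le> 0" by (simp add: mult_le_0_iff)
  with J0 have "J = 0" by simp
  with IJ have "I \<le> 0" by simp
  have ch: "continuous_on UNIV h"
    unfolding h[symmetric] by (intro continuous_intros continuous_on_trace[OF u(1)])
  have "u x * h x = 0"
    by (rule continuous_nonneg_integral_0[OF _ _ iuh])
       (use \<open>I \<le> 0\<close> order_trans[OF Phi(1,2)] in \<open>auto intro!: continuous_intros du ch simp: I_def\<close>)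
  then show "u x = 0"
    using pos[of "u x"] u(2)[of x] by (auto simp: h_def less_le)
qed

theorem theorem1p23:
  fixes f :: "real \<Rightarrow> real" and u :: "real ^ 'n \<Rightarrow> real" and q0 p0 :: ereal
  assumes "continuous_on {0..} f"
    and "C2_real_on {0<..} f"
    and "mono_on {0..} f"
    and "convex_on {0..} f"
    and "\<forall>s>0. f s > 0"
    and "(q_fun f \<longlongrightarrow> q0) (at_right 0)"
    and "p0 = conj_exponent q0"
    and "C2_fun u"
    and "bounded (range u)"
    and "\<forall>x. u x \<ge> 0"
    and "\<forall>x. - laplacian u x = f (u x)"
    and "stable_outside_compact f u"
    and "CARD('n) \<le> 2 \<longrightarrow> p0 < \<infinity>"
    and "CARD('n) \<ge> 3 \<longrightarrow> p0 < ereal ((real CARD('n) + 2) / (real CARD('n) - 2))"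
    and "\<forall>s\<ge>0. (p0 + 1) * ereal (integral {0..s} f) \<ge> ereal (s * f s)"
  shows "\<forall>x. u x = 0"
proof
  fix x :: "real ^ 'n"
  note c = assms(1) and C2 = assms(2) and mono = assms(3) and cv = assms(4)
  have pos: "f s > 0" if "s > 0" for s using assms(5) that by blast
  obtain H where u: "has_hessian u (gradient u) H" and lap: "\<And>x. laplacian u x = (\<Sum>b\<in>Basis. H x b \<bullet> b)"
    using C2_fun_has_hessian[OF assms(8)] by blast
  have u0: "u x \<ge> 0" for x using assms(10) by blast
  have eq: "- (\<Sum>b\<in>Basis. H x b \<bullet> b) = f (u x)" for x using assms(11) lap by simp
  obtain M0 where M0: "\<forall>y\<in>range u. norm y \<le> M0" using assms(9) unfolding bounded_iff by blast
  define M where "M = max M0 1"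
  have M: "M > 0" "u x \<le> M" for x using M0 by (auto simp: M_def abs_le_iff le_max_iff_disj)
  have cf: "continuous_on UNIV (\<lambda>x. f (u x))"
    by (rule continuous_on_compose2[OF c has_hessianD(4)[OF u]]) (use u0 in auto)
  have d1: "(f has_real_derivative deriv f s) (at s)"
    and d2: "(deriv f has_real_derivative deriv (deriv f) s) (at s)" if "s > 0" for s
    using C2 that unfolding C2_real_on_def by (auto simp: DERIV_deriv_iff_real_differentiable)
  define N where "N = real CARD('n)"
  have N: "N = real DIM(real ^ 'n)" "N \<ge> 1" by (auto simp: N_def Suc_le_eq)
  have serrin: "f (u x) = 0"
    if k: "k > 0" "\<And>s. 0 \<le> s \<Longrightarrow> s \<le> M \<Longrightarrow> k * s powr (q + 1) \<le> f s" and q: "q > 0" "N < 2 + 2 / q" for k q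
  proof (rule liouville_serrin_range[OF u u0 eq cf k(1) q(1)])
    show "k * (u x * u x powr q) \<le> f (u x)" for x
      using k(2)[OF u0 M(2), of x] powr_mult_base[OF u0[of x], of q] by (simp add: add.commute)
    show "real DIM(real ^ 'n) < 2 + 2 / q" using q(2) N by simp
  qed
  \<comment> \<open>The exponent 1/N lies in Serrin's range in every dimension; it serves whenever
    an arbitrarily small positive q is good enough.\<close>
  have Nq: "N < 2 + 2 / (1 / N)" using N by simp
  show "u x = 0"
  proof (cases "f 0 = 0")
    case False
    have "f 0 \<ge> 0"
    proof (rule tendsto_lowerbound)
      show "(f \<longlongrightarrow> f 0) (at_right 0)"
        using c unfolding continuous_on_def by (auto intro: tendsto_within_subset)
      show "\<forall>\<^sub>F s in at_right 0. 0 \<le> f s"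
        using eventually_at_right_less[of "0::real"] pos by (auto elim!: eventually_mono intro: less_imp_le)
    qed simp
    with False have f0: "f 0 > 0" by simp
    have ge: "f s \<ge> f 0" if "s \<ge> 0" for s using mono that by (auto simp: mono_on_def)
    \<comment> \<open>On the bounded range of u, a positive lower bound for f dominates a multiple
      of any positive power. The conclusion contradicts \<open>f 0 > 0\<close>, so this case does
      not occur.\<close>
    have "f (u x) = 0"
    proof (rule serrin[where k = "f 0 / M powr (1 / N + 1)" and q = "1 / N"])
      show "f 0 / M powr (1 / N + 1) * s powr (1 / N + 1) \<le> f s" if "0 \<le> s" "s \<le> M" for s
      proof -
        have "f 0 / M powr (1 / N + 1) * s powr (1 / N + 1) \<le> f 0 / M powr (1 / N + 1) * M powr (1 / N + 1)"
          using that f0 N by (intro mult_left_mono powr_mono2) auto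
        then show ?thesis using M(1) ge[OF that(1)] by simp
      qed
    qed (use f0 M N Nq in auto)
    then show ?thesis using ge[OF u0, of x] f0 by simp
  next
    case True
    have fin: "conj_exponent q0 \<noteq> \<infinity>"
      using assms(7,13,14) by (cases "CARD('n) \<le> 2") auto
    obtain p where p: "1 \<le> p" "conj_exponent q0 = ereal p"
      and lim: "((\<lambda>s. s * deriv f s / f s) \<longlongrightarrow> p) (at_right 0)"
      using log_derivative_tendsto_conj_exponent[OF cv True pos d1 d2 assms(6)[unfolded q_fun_def[abs_def]] fin] by blast
    have zero: "u x = 0" if q: "q > 0" "N < 2 + 2 / q" "p < q + 1" for q
    proof -
      obtain k where "k > 0" "\<And>s. 0 \<le> s \<Longrightarrow> s \<le> M \<Longrightarrow> k * s powr (q + 1) \<le> f s"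
        using power_lower_bound[OF mono True pos d1 lim q(3) _ M(1)] q(1) by auto
      then have "f (u x) = 0" using serrin q by blast
      then show ?thesis using pos[of "u x"] u0[of x] by (auto simp: less_le)
    qed
    consider "CARD('n) \<le> 2" | "p = 1" | "CARD('n) \<ge> 3" "p > 1" using p(1) by linarith
    then show ?thesis
    proof cases
      case 1
      then have "N \<le> 2" by (simp add: N_def)
      \<comment> \<open>In dimension at most 2 every positive q is admissible; q = p ensures q + 1 >
        p.\<close>
      then have "N < 2 + 2 / p" using p(1) by (intro le_less_trans[of N 2]) auto
      then show ?thesis using p(1) by (intro zero[of p]) auto
    next
      case 2
      then show ?thesis using N Nq by (intro zero[of "1 / N"]) auto
    next
      case 3
      show ?thesis
      proof (rule stable_subcritical_liouville[OF c C2 mono cv pos True u u0 M(2) eq assms(12) lim 3(2)])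
        show "DIM(real ^ 'n) \<ge> 3" using 3 by simp
        show "p < (real DIM(real ^ 'n) + 2) / (real DIM(real ^ 'n) - 2)"
          using assms(7,14) 3 p by simp
        show "s * f s \<le> (p + 1) * integral {0..s} f" if "s \<ge> 0" for s
          using assms(7,15) that p(2) by (simp add: one_ereal_def)
      qed
    qed
  qed
qed

end
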